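(* Each dilatation in a finite Desargues affine plane $\mathcal{A}_{\mathcal{D}}=(\mathcal{P},\mathcal{L},\mathcal{I})$ occurs in a Pappian space (that is, the finite Desargues affine plane in which the dilatation acts is Pappian).
   Context: An affine plane consists of a nonempty set $\mathcal{P}$ of points, a collection $\mathcal{L}$ of subsets of $\mathcal{P}$ called lines, and incidence $\mathcal{I}$ (membership), such that: (1) any two distinct points $P,Q$ lie on exactly one line, denoted $\ell_{PQ}$; (2) for every line $\ell$ and point $P\notin\ell$ there is exactly one line through $P$ disjoint from $\ell$; (3) there are three non-collinear points. It is finite if $\mathcal{P}$ is finite. Lines are parallel ($\parallel$) if they are equal or disjoint. A Desargues affine plane is an affine plane satisfying the following Desargues axiom. Let $\ell_k,\ell_l,\ell_m,\ell_{AC},\ell_{A'C'}$ be pairwise distinct lines with $\ell_k\parallel\ell_l\parallel\ell_m$, and let $A,A'\in\ell_k$, $B,B'\in\ell_l$, $C,C'\in\ell_m$ be such that $\ell_{AB}\parallel\ell_{A'B'}$, $\ell_{BC}\parallel\ell_{B'C'}$, $A\neq C$, $A'\neq C'$, $\ell_{AB}\neq\ell_l$, $\ell_{BC}\neq\ell_l$. Then $\ell_{AC}\parallel\ell_{A'C'}$. A dilatation is a bijection $\delta:\mathcal{P}\to\mathcal{P}$ taking lines to lines such that the line $\ell_{\delta(P)\delta(Q)}$ is parallel to $\ell_{PQ}$ for all $P\neq Q$. A space $(\mathcal{P},\mathcal{L})$ is Pappian provided the theorem of Pappus holds in it, stated as follows: let $P_1,P_2,P_3,P_4,P_5,P_6\in\mathcal{P}$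 and $|\ell_{P_1P_3}\cap\ell_{P_2P_3}|=1$; then $\ell_{P_3P_4}\parallel\ell_{P_1P_6}$.
   Formalization: Desargues axiom is assumed for concurrent as well as parallel carrier lines (vertices not the centre), and Pappus gets its missing premises: P1,P3,P5 and P2,P4,P6 collinear, P1P2 ∥ P4P5, P2P3 ∥ P5P6, joined points distinct; as printed the claim is false. *)

theory Defs
  imports Main
begin

definition parallel :: "'a set \<Rightarrow> 'a set \<Rightarrow> bool" where
  "parallel l m \<longleftrightarrow> l = m \<or> l \<inter> m = {}"

text \<open>
  The line joining \<open>P\<close> and \<open>Q\<close>. In an affine plane it is well defined whenever \<open>P\<close> and \<open>Q\<close> are
  distinct points; below it is only used for pairs that are distinct, by assumption or as a
  consequence of the other assumptions.
\<close>

definition line_through :: "'a set set \<Rightarrow> 'a \<Rightarrow> 'a \<Rightarrow> 'a set" where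
  "line_through L P Q = (THE l. l \<in> L \<and> P \<in> l \<and> Q \<in> l)"

definition collinear3 :: "'a set set \<Rightarrow> 'a \<Rightarrow> 'a \<Rightarrow> 'a \<Rightarrow> bool" where
  "collinear3 L P Q R \<longleftrightarrow> (\<exists>l\<in>L. P \<in> l \<and> Q \<in> l \<and> R \<in> l)"

locale affine_plane =
  fixes Pts :: "'a set" and L :: "'a set set"
  assumes points_nonempty: "Pts \<noteq> {}"
    and lines_subset: "\<And>l. l \<in> L \<Longrightarrow> l \<subseteq> Pts"
    and join_unique: "\<And>P Q. P \<in> Pts \<Longrightarrow> Q \<in> Pts \<Longrightarrow> P \<noteq> Q \<Longrightarrow> \<exists>!l. l \<in> L \<and> P \<in> l \<and> Q \<in> l"
    and parallel_unique: "\<And>l P. l \<in> L \<Longrightarrow> P \<in> Pts \<Longrightarrow> P \<notin> l \<Longrightarrow>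
          \<exists>!m. m \<in> L \<and> P \<in> m \<and> m \<inter> l = {}"
    and three_points: "\<exists>P\<in>Pts. \<exists>Q\<in>Pts. \<exists>R\<in>Pts.
          P \<noteq> Q \<and> P \<noteq> R \<and> Q \<noteq> R \<and> \<not> collinear3 L P Q R"

text \<open>
  The Desargues axiom for carrier lines \<open>k\<close>, \<open>l\<close>, \<open>m\<close> that are parallel or meet in a common point
  \<open>S\<close>. With parallel carriers only, the axiom characterises translation planes, and the nearfield
  plane of order 9 is a finite one that is not Pappian.

  If the carriers are parallel, the conditions \<open>A \<noteq> C\<close>, \<open>A' \<noteq> C'\<close>, \<open>line_through L A B \<noteq> l\<close> and
  \<open>line_through L B C \<noteq> l\<close> hold automatically. If they meet in \<open>S\<close>, the vertices have to differ from
  \<open>S\<close>: for \<open>B = B' = S\<close> these conditions would not prevent \<open>A\<close>, \<open>A'\<close>, \<open>C\<close>, \<open>C'\<close> from being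
  arbitrary points of \<open>k\<close> and \<open>m\<close>.
\<close>

definition desargues_axiom :: "'a set set \<Rightarrow> bool" where
  "desargues_axiom L \<longleftrightarrow>
    (\<forall>k\<in>L. \<forall>l\<in>L. \<forall>m\<in>L. \<forall>A\<in>k. \<forall>A'\<in>k. \<forall>B\<in>l. \<forall>B'\<in>l. \<forall>C\<in>m. \<forall>C'\<in>m.
      distinct [k, l, m, line_through L A C, line_through L A' C'] \<longrightarrow>
      (parallel k l \<and> parallel l m) \<or>
        (\<exists>S. k \<inter> l \<inter> m = {S} \<and> S \<notin> {A, A', B, B', C, C'}) \<longrightarrow>
      parallel (line_through L A B) (line_through L A' B') \<longrightarrow>
      parallel (line_through L B C) (line_through L B' C') \<longrightarrow>
      A \<noteq> C \<longrightarrow> A' \<noteq> C' \<longrightarrow> line_through L A B \<noteq> l \<longrightarrow> line_through L B C \<noteq> l \<longrightarrow>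
      parallel (line_through L A C) (line_through L A' C'))"

locale desargues_affine_plane = affine_plane +
  assumes desargues: "desargues_axiom L"

locale finite_desargues_affine_plane = desargues_affine_plane +
  assumes finite_points: "finite Pts"

definition dilatation :: "'a set \<Rightarrow> 'a set set \<Rightarrow> ('a \<Rightarrow> 'a) \<Rightarrow> bool" where
  "dilatation Pts L \<delta> \<longleftrightarrow>
    bij_betw \<delta> Pts Pts \<and>
    (\<forall>l\<in>L. \<delta> ` l \<in> L) \<and>
    (\<forall>P\<in>Pts. \<forall>Q\<in>Pts. P \<noteq> Q \<longrightarrow> parallel (line_through L (\<delta> P) (\<delta> Q)) (line_through L P Q))"

text \<open>
  The affine theorem of Pappus for the hexagon \<open>P1 P2 P3 P4 P5 P6\<close> inscribed in the lines \<open>P1 P3 P5\<close>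
  and \<open>P2 P4 P6\<close>: if two pairs of opposite sides are parallel, so is the third. The inequations
  only say that points joined by a line are distinct. The cardinality condition means that \<open>P2\<close> is
  not on the first carrier line. If the two carriers cross in one point, it follows from
  the other premises (lemma \<open>pappian_crossing\<close> below); parallel carriers are also covered.
\<close>

definition pappian :: "'a set \<Rightarrow> 'a set set \<Rightarrow> bool" where
  "pappian Pts L \<longleftrightarrow>
    (\<forall>P1\<in>Pts. \<forall>P2\<in>Pts. \<forall>P3\<in>Pts. \<forall>P4\<in>Pts. \<forall>P5\<in>Pts. \<forall>P6\<in>Pts.
      P1 \<noteq> P3 \<longrightarrow> P2 \<noteq> P4 \<longrightarrow>
      P1 \<noteq> P2 \<longrightarrow> P2 \<noteq> P3 \<longrightarrow> P3 \<noteq> P4 \<longrightarrow> P4 \<noteq> P5 \<longrightarrow> P5 \<noteq> P6 \<longrightarrow> P6 \<noteq> P1 \<longrightarrow>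
      card (line_through L P1 P3 \<inter> line_through L P2 P3) = 1 \<longrightarrow>
      P5 \<in> line_through L P1 P3 \<longrightarrow> P6 \<in> line_through L P2 P4 \<longrightarrow>
      parallel (line_through L P1 P2) (line_through L P4 P5) \<longrightarrow>
      parallel (line_through L P2 P3) (line_through L P5 P6) \<longrightarrow>
      parallel (line_through L P3 P4) (line_through L P1 P6))"

context affine_plane
begin

lemma line_through:
  assumes "P \<in> Pts" "Q \<in> Pts" "P \<noteq> Q"
  shows "line_through L P Q \<in> L" "P \<in> line_through L P Q" "Q \<in> line_through L P Q"
  using theI'[OF join_unique[OF assms]] unfolding line_through_def by auto

lemma line_through_eq:
  assumes "l \<in> L" "P \<in> l" "Q \<in> l" "P \<noteq> Q"
  shows "line_through L P Q = l"
proof -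
  have "P \<in> Pts" "Q \<in> Pts" using assms lines_subset by auto
  then show ?thesis
    unfolding line_through_def using assms join_unique by (intro the1_equality) auto
qed

lemma pappian_crossing:
  assumes pap: "pappian Pts L"
    and pts: "P1 \<in> Pts" "P2 \<in> Pts" "P3 \<in> Pts" "P4 \<in> Pts" "P5 \<in> Pts" "P6 \<in> Pts"
    and ne: "P1 \<noteq> P3" "P2 \<noteq> P4"
      "P1 \<noteq> P2" "P2 \<noteq> P3" "P3 \<noteq> P4" "P4 \<noteq> P5" "P5 \<noteq> P6" "P6 \<noteq> P1"
    and cross: "card (line_through L P1 P3 \<inter> line_through L P2 P4) = 1"
    and col: "P5 \<in> line_through L P1 P3" "P6 \<in> line_through L P2 P4"
    and par: "parallel (line_through L P1 P2) (line_through L P4 P5)"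
      "parallel (line_through L P2 P3) (line_through L P5 P6)"
  shows "parallel (line_through L P3 P4) (line_through L P1 P6)"
proof -
  note lt = line_through
  define l where "l = line_through L P1 P3"
  have l: "l \<in> L" "P1 \<in> l" "P3 \<in> l" "P5 \<in> l"
    using lt[of P1 P3] pts ne col unfolding l_def by auto
  have "P2 \<notin> l"
  proof
    assume P2: "P2 \<in> l"
    have "line_through L P1 P2 = l" using l P2 ne line_through_eq by blast
    then have "line_through L P4 P5 = l"
      using par(1) lt[of P4 P5] pts ne l unfolding parallel_def by auto
    then have "P4 \<in> l" using lt[of P4 P5] pts ne by auto
    then have "line_through L P2 P4 = l" using P2 l ne line_through_eq by blast
    then have "card l = 1" using cross unfolding l_def by simp
    then show False using l ne by (metis card_1_singletonE singletonD)
  qed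
  moreover have "line_through L P2 P3 \<in> L" "P2 \<in> line_through L P2 P3" "P3 \<in> line_through L P2 P3"
    using lt[of P2 P3] pts ne by auto
  ultimately have "l \<inter> line_through L P2 P3 = {P3}"
    using l line_through_eq by blast
  then have "card (line_through L P1 P3 \<inter> line_through L P2 P3) = 1"
    unfolding l_def by simp
  with pap show ?thesis unfolding pappian_def using pts ne col par by blast
qed

end

end

(*
  Desargues' axiom yields, for every parallel class and every pencil of lines through a point, a
  dilatation that preserves the lines of the pencil and moves a given point to any other point of
  its line. The translations form an abelian group acting regularly on the points, so the points
  become an abelian group partitioned by the lines through the origin; the endomorphisms preserving
  these lines form a finite division ring, which is commutative by Wedderburn's theorem. Pappus'
  theorem for crossing carriers is the commutativity of this ring, for parallel carriers that of
  the translation group.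

  Wedderburn's theorem is Witt's class equation argument, with a prime factor of X^n - 1 over the
  integers that vanishes at a primitive n-th root of unity in place of the cyclotomic polynomial.

  The construction of the dilatations needs three lines in the pencil. If some parallel class has
  only two lines, every line has two points, and Pappus' theorem degenerates.
*)

theory Submission
  imports Defs
    "HOL-Computational_Algebra.Polynomial_Factorial"
    "HOL-Computational_Algebra.Fundamental_Theorem_Algebra"
    "HOL-Algebra.Group_Action"
    "HOL-Algebra.Ring"
begin

section \<open>Wedderburn's theorem\<close>

text \<open>No coordinates are introduced: scalars are maps on the points, and homotheties supply
  them. The origin is chosen anew for each hexagon, at the crossing point of its carriers, so that
  every scalar preserves both carriers. A scalar is known from its value at one nonzero vector, so
  relations among scalars are read off at a single vertex. Desargues' axiom transports an image
  point only between different lines of a pencil. Points on the line of the given point therefore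
  need an auxiliary point off it, and fitting the two pieces together is what calls for a third
  line. Finiteness enters in two ways: through Wedderburn's theorem, and by turning injective maps
  into bijective ones. Witt's argument uses only divisibility and size of one integer. A prime
  factor f of X^n - 1 with a primitive n-th root of unity among its roots provides it: f cannot
  divide X^d - 1 for a proper divisor d of n, so it divides the quotient; and its complex roots are
  roots of unity other than 1, so its value at q is larger than q - 1 in absolute value.\<close>

lemma primitive_root_of_unity_power_ne_1:
  fixes n d :: nat
  assumes "0 < d" "d < n"
  shows "cis (2 * pi / real n) ^ d \<noteq> 1"
proof
  assume "cis (2 * pi / real n) ^ d = 1"
  then have "cis (real d * (2 * pi / real n)) = cis 0" by (simp add: DeMoivre)
  then have "cos (real d * (2 * pi / real n)) = 1"
    by (metis cis.sel(1) cos_zero)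
  then obtain k :: int where k: "real d * (2 * pi / real n) = of_int k * (2 * pi)"
    using cos_one_2pi_int by (metis mult.assoc)
  then have "real d = of_int k * real n"
    using assms by (auto simp: field_simps)
  then have "int d = k * int n" by (metis of_int_eq_iff of_int_mult of_int_of_nat_eq)
  then have "int n dvd int d" by simp
  then show False using assms by (auto dest: dvd_imp_le)
qed

abbreviation complex_poly :: "int poly \<Rightarrow> complex poly" where
  "complex_poly \<equiv> map_poly of_int"

lemma complex_poly_mult: "complex_poly (p * q) = complex_poly p * complex_poly q"
  by (intro poly_eqI) (simp add: coeff_map_poly coeff_mult)

lemma complex_poly_monom_diff:
  "poly (complex_poly (monom 1 n - 1)) z = z ^ n - 1"
proof -
  have "complex_poly (monom 1 n - 1) = monom 1 n - 1"
    by (intro poly_eqI) (auto simp: coeff_map_poly)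
  then show ?thesis by (simp add: poly_monom)
qed

lemma poly_complex_poly_of_int:
  "poly (complex_poly p) (of_int x) = of_int (poly p x)"
  by (induction p) (auto simp: map_poly_pCons)

text \<open>The factor is taken over the integers so that divisibility of polynomials passes to
  their values at integers; as a prime element it can be pushed into one factor of a
  product.\<close>

lemma exists_prime_factor_root:
  fixes p :: "int poly" and z :: complex
  assumes "p \<noteq> 0" "poly (complex_poly p) z = 0"
  shows "\<exists>f. prime_elem f \<and> f dvd p \<and> poly (complex_poly f) z = 0"
  using assms
proof (induction p rule: prime_divisors_induct)
  case zero
  then show ?case by simp
next
  case (unit u)
  then obtain v where uv: "u * v = 1" by (metis dvdE)
  have "complex_poly u * complex_poly v = 1"
    by (simp flip: complex_poly_mult add: uv)
  then show ?case using unit by (metis mult_zero_left one_neq_zero poly_1 poly_mult)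
next
  case (factor q p)
  then show ?case
    by (cases "poly (complex_poly q) z = 0") (auto simp: complex_poly_mult intro: dvd_mult)
qed

text \<open>On the unit circle only 1 has real part 1, so \<open>q - z\<close> has real part greater
  than q - 1.\<close>

lemma norm_gt_if_unit_root:
  fixes z :: complex and q :: nat
  assumes "norm z = 1" "z \<noteq> 1" "2 \<le> q"
  shows "norm (of_nat q - z) > real q - 1"
proof -
  have "Re z \<le> 1" using assms(1) complex_Re_le_cmod[of z] by simp
  moreover have "Re z \<noteq> 1"
  proof
    assume r: "Re z = 1"
    then have "Im z = 0" using assms(1) cmod_power2[of z] by simp
    then show False using r assms(2) by (simp add: complex_eq_iff)
  qed
  ultimately have "real q - 1 < Re (of_nat q - z)" by simp
  then show ?thesis using complex_Re_le_cmod[of "of_nat q - z"] by linarith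
qed

text \<open>Made for the class equation: with q the order of the centre of a division ring of order
  q^n, \<open>c\<close> will divide the order of the unit group and the size of each noncentral
  conjugacy class, but not the number q - 1 of central units.\<close>

lemma cyclotomic_value:
  fixes n q :: nat
  assumes n: "1 < n" and q: "2 \<le> q"
  obtains c :: int where "c dvd int q ^ n - 1"
    "\<And>d. d dvd n \<Longrightarrow> d < n \<Longrightarrow> c * (int q ^ d - 1) dvd int q ^ n - 1"
    "\<not> c dvd int q - 1"
proof -
  define X where "X = (\<lambda>k. monom 1 k - 1 :: int poly)"
  define \<zeta> where "\<zeta> = cis (2 * pi / real n)"
  have "X n \<noteq> 0" using n unfolding X_def by (simp add: monom_eq_1_iff)
  moreover have "\<zeta> ^ n = 1" using n unfolding \<zeta>_def by (simp add: DeMoivre)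
  then have "poly (complex_poly (X n)) \<zeta> = 0"
    unfolding X_def by (simp add: complex_poly_monom_diff)
  ultimately obtain f where f: "prime_elem f" "f dvd X n" "poly (complex_poly f) \<zeta> = 0"
    using exists_prime_factor_root by blast
  \<comment> \<open>The primitive root \<open>\<zeta>\<close> is a root of \<open>f\<close> but not
    of X^d - 1, so the prime \<open>f\<close> has to divide the cofactor.\<close>
  have key: "\<exists>g. X n = X d * g \<and> f dvd g" if d: "d dvd n" "d < n" for d
  proof -
    obtain k where k: "n = d * k" using d by auto
    have "monom 1 n = (monom 1 d :: int poly) ^ k" by (simp add: monom_power k mult.commute)
    then have e: "X n = X d * (\<Sum>i<k. monom 1 d ^ i)"
      unfolding X_def by (simp add: power_diff_1_eq)
    have "0 < d" using d n by (auto intro: Nat.gr0I)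
    then have "\<zeta> ^ d \<noteq> 1" using d primitive_root_of_unity_power_ne_1 unfolding \<zeta>_def by blast
    then have "poly (complex_poly (X d)) \<zeta> \<noteq> 0"
      unfolding X_def by (simp add: complex_poly_monom_diff)
    then have "\<not> f dvd X d" using f(3) by (auto simp: complex_poly_mult)
    then show ?thesis using f(1,2) e by (metis prime_elem_dvd_mult_iff)
  qed
  have root: "norm z = 1 \<and> z \<noteq> 1" if z: "poly (complex_poly f) z = 0" for z
  proof -
    have "poly (complex_poly (X n)) z = 0" using f(2) z by (auto simp: complex_poly_mult)
    then have zn: "z ^ n = 1" unfolding X_def by (simp add: complex_poly_monom_diff)
    then have "norm z ^ n = 1" by (metis norm_one norm_power)
    then have "norm z = 1" using n using n power_eq_iff_eq_base[of n "norm z" 1] by simp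
    moreover have "z \<noteq> 1"
    proof
      assume z1: "z = 1"
      \<comment> \<open>For d = 1 the cofactor is 1 + X + ... + X^(n-1). It is a multiple of
        \<open>f\<close>, yet its value at 1 is n.\<close>
      obtain g where g: "X n = X 1 * g" "f dvd g" using key[of 1] n by auto
      have "X n = X 1 * (\<Sum>i<n. monom 1 i)"
        using power_diff_1_eq[of "monom 1 1 :: int poly" n] unfolding X_def by (simp add: monom_power)
      moreover have "X 1 \<noteq> 0" unfolding X_def by (simp add: monom_eq_1_iff)
      ultimately have "g = (\<Sum>i<n. monom 1 i)" using g(1) by simp
      then have "poly g 1 = int n" by (simp add: poly_sum poly_monom)
      moreover have "poly (complex_poly g) 1 = 0"
        using g(2) z z1 by (auto simp: complex_poly_mult)
      then have "poly g 1 = 0" using poly_complex_poly_of_int[of g 1] by simp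
      ultimately show False using n by simp
    qed
    ultimately show ?thesis by simp
  qed
  define c where "c = poly f (int q)"
  have pX: "poly (X k) (int q) = int q ^ k - 1" for k
    unfolding X_def by (simp add: poly_monom)
  \<comment> \<open>Split \<open>f\<close> into complex linear factors. The leading coefficient is a
    nonzero integer and each linear factor exceeds q - 1, which is at least 1, in norm; since
    \<open>f\<close> has a root, there is at least one such factor.\<close>
  have large: "\<bar>c\<bar> > int q - 1"
  proof -
    obtain r where r: "smult (lead_coeff (complex_poly f)) (\<Prod>i<degree (complex_poly f). [:- r i, 1:]) = complex_poly f"
      using complex_poly_decompose' by blast
    let ?m = "degree (complex_poly f)" and ?a = "lead_coeff (complex_poly f)"
    have f0: "f \<noteq> 0" using f(1) by auto
    have deg: "?m = degree f" by (simp add: degree_map_poly)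
    have a: "?a = of_int (lead_coeff f)" by (simp add: coeff_map_poly deg)
    have "norm ?a \<ge> 1" using f0 unfolding a by (simp add: norm_of_int)
      (metis abs_ge_self int_one_le_iff_zero_less leading_coeff_0_iff of_int_1_le_iff of_int_abs zero_less_abs_iff)
    have m: "?m > 0"
    proof (rule ccontr)
      assume "\<not> ?m > 0"
      then obtain b where "complex_poly f = [:b:]" by (metis degree_eq_zeroE gr0I)
      then have "complex_poly f = 0" using f(3) by simp
      then show False using f0 a by simp
    qed
    have rr: "norm (of_nat q - r i) > real q - 1" if "i < ?m" for i
    proof -
      have "poly (complex_poly f) (r i) = 0"
        by (subst r[symmetric]) (use that in \<open>auto simp: poly_prod\<close>)
      then show ?thesis using root q norm_gt_if_unit_root by blast
    qed
    have "real q - 1 < (\<Prod>i<?m. norm (of_nat q - r i))"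
    proof -
      obtain m' where m': "?m = Suc m'" using m by (metis gr0_implies_Suc)
      have "1 \<le> (\<Prod>i<m'. norm (of_nat q - r i))"
        by (rule prod_ge_1) (use rr m' q in \<open>force simp: less_Suc_eq\<close>)
      moreover have "real q - 1 < norm (of_nat q - r m')" using rr m' by simp
      ultimately show ?thesis unfolding m'
        using mult_mono[of 1 "(\<Prod>i<m'. norm (of_nat q - r i))" "norm (of_nat q - r m')" "norm (of_nat q - r m')"] by simp
    qed
    also have "\<dots> \<le> norm ?a * (\<Prod>i<?m. norm (of_nat q - r i))"
      using mult_right_mono[OF \<open>norm ?a \<ge> 1\<close>, of "\<Prod>i<?m. norm (of_nat q - r i)"]
      by (simp add: prod_nonneg)
    also have "\<dots> = norm (poly (complex_poly f) (of_nat q))"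
      by (subst (3) r[symmetric]) (simp add: poly_prod norm_mult prod_norm)
    also have "\<dots> = real_of_int \<bar>c\<bar>"
      using poly_complex_poly_of_int[of f "int q"] unfolding c_def by (simp add: norm_of_int)
    finally show ?thesis by linarith
  qed
  show ?thesis
  proof (rule that)
    show "c dvd int q ^ n - 1" using f(2) unfolding c_def pX[symmetric] by auto
    show "\<not> c dvd int q - 1" using large q zdvd_imp_le[of "\<bar>c\<bar>" "int q - 1"] by auto
  next
    fix d assume "d dvd n" "d < n"
    then obtain g where "X n = X d * g" "f dvd g" using key by blast
    then show "c * (int q ^ d - 1) dvd int q ^ n - 1"
      unfolding c_def pX[symmetric] by auto
  qed
qed

section \<open>Centralizers and the class equation\<close>

definition centralizer :: "('a, 'b) monoid_scheme \<Rightarrow> 'a \<Rightarrow> 'a set" where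
  "centralizer G x = {y \<in> carrier G. y \<otimes>\<^bsub>G\<^esub> x = x \<otimes>\<^bsub>G\<^esub> y}"

text \<open>Like \<open>centralizer\<close>, stated over monoids, so that it applies both to a ring
  and to its group of units.\<close>

definition centre :: "('a, 'b) monoid_scheme \<Rightarrow> 'a set" where
  "centre G = {x \<in> carrier G. \<forall>y\<in>carrier G. x \<otimes>\<^bsub>G\<^esub> y = y \<otimes>\<^bsub>G\<^esub> x}"

text \<open>The class equation modulo \<open>c\<close>: by \<open>noncentral\<close> the index of
  each proper centralizer, hence the size of each noncentral conjugacy class, is a multiple of
  \<open>c\<close>.\<close>

lemma (in group) dvd_card_centre:
  fixes c :: int
  assumes fin: "finite (carrier G)"
    and c: "c dvd int (Coset.order G)"
    and noncentral: "\<And>x. x \<in> carrier G \<Longrightarrow> x \<notin> centre G \<Longrightarrow>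
      c * int (card (centralizer G x)) dvd int (Coset.order G)"
  shows "c dvd int (card (centre G))"
proof -
  define \<phi> where "\<phi> = (\<lambda>g. \<lambda>h \<in> carrier G. g \<otimes> h \<otimes> inv g)"
  interpret A: group_action G "carrier G" \<phi>
    unfolding \<phi>_def by (rule action_by_conjugation)
  \<comment> \<open>Indicator of the noncentral elements. Summed over a conjugacy class it gives 0
    or the size of the class, so the central classes need not be sorted out.\<close>
  define f where "f = (\<lambda>x. if x \<in> centre G then 0 else 1 :: int)"
  have move: "g \<otimes> x \<otimes> inv g = y \<longleftrightarrow> g \<otimes> x = y \<otimes> g"
    if "g \<in> carrier G" "x \<in> carrier G" "y \<in> carrier G" for g x y
    using that by (metis inv_solve_right m_closed)
  have orb: "c dvd (\<Sum>y\<in>orb. f y)" if orb: "orb \<in> orbits G (carrier G) \<phi>" for orb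
  proof -
    obtain x where x: "x \<in> carrier G" "orb = orbit G \<phi> x"
      using orb unfolding orbits_def by blast
    have orb_eq: "orb = {g \<otimes> x \<otimes> inv g | g. g \<in> carrier G}"
      unfolding x(2) orbit_def \<phi>_def using x(1) by auto
    show ?thesis
    proof (cases "x \<in> centre G")
      case True
      have "y = x" if y: "y \<in> orb" for y
      proof -
        obtain g where g: "g \<in> carrier G" "y = g \<otimes> x \<otimes> inv g" using y unfolding orb_eq by auto
        have "g \<otimes> x = x \<otimes> g" using True g x unfolding centre_def by auto
        then show ?thesis using g x move by metis
      qed
      then have "(\<Sum>y\<in>orb. f y) = 0" using True by (intro sum.neutral) (auto simp: f_def)
      then show ?thesis by simp
    next
      case False
      have "y \<notin> centre G" if yo: "y \<in> orb" for y
      proof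
        assume y: "y \<in> centre G"
        obtain g where g: "g \<in> carrier G" "y = g \<otimes> x \<otimes> inv g" using yo unfolding orb_eq by auto
        have yc: "y \<in> carrier G" using y unfolding centre_def by auto
        have "g \<otimes> x = y \<otimes> g" using g x yc move by metis
        also have "\<dots> = g \<otimes> y" using y g unfolding centre_def by auto
        finally have "x = y" using g x yc by (metis Units_eq Units_l_cancel)
        then show False using y False by simp
      qed
      then have "(\<Sum>y\<in>orb. f y) = (\<Sum>y\<in>orb. 1)"
        by (intro sum.cong) (auto simp: f_def)
      also have "\<dots> = int (card orb)" by simp
      finally have s: "(\<Sum>y\<in>orb. f y) = int (card orb)" .
      have "stabilizer G \<phi> x = centralizer G x"
        unfolding stabilizer_def centralizer_def \<phi>_def using x(1) move by auto
      then have os: "int (card orb) * int (card (centralizer G x)) = int (Coset.order G)"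
        using A.orbit_stabilizer_theorem[OF x(1)] x(2) by (metis of_nat_mult)
      moreover have "x \<in> centralizer G x" "finite (centralizer G x)"
        using x(1) fin unfolding centralizer_def by auto
      then have "card (centralizer G x) \<noteq> 0" by auto
      ultimately have "c dvd int (card orb)"
        using noncentral[OF x(1) False] by (metis dvd_mult_cancel_right of_nat_eq_0_iff)
      then show ?thesis using s by simp
    qed
  qed
  have "(\<Sum>x\<in>carrier G. f x) = (\<Sum>orb\<in>orbits G (carrier G) \<phi>. \<Sum>y\<in>orb. f y)"
    using A.disjoint_sum[OF fin] by metis
  then have d: "c dvd (\<Sum>x\<in>carrier G. f x)" using orb by (simp add: dvd_sum)
  have "centre G \<subseteq> carrier G" unfolding centre_def by auto
  then have "(\<Sum>x\<in>carrier G. 1 - f x) = int (card (centre G))"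
    using fin by (subst sum.mono_neutral_right[of _ "centre G"]) (auto simp: f_def)
  then have "int (card (centre G)) = int (Coset.order G) - (\<Sum>x\<in>carrier G. f x)"
    by (simp add: sum_subtractf Coset.order_def)
  then show ?thesis using c d by simp
qed

section \<open>Finite division rings as left spaces over their division subrings\<close>

locale finite_division_ring = ring R for R (structure) +
  assumes finite_carrier: "finite (carrier R)"
    and Units_eq: "Units R = carrier R - {\<zero>}"
begin

definition division_subring :: "'a set \<Rightarrow> bool" where
  "division_subring K \<longleftrightarrow> K \<subseteq> carrier R \<and> \<one> \<in> K \<and>
    (\<forall>x\<in>K. \<forall>y\<in>K. x \<ominus> y \<in> K \<and> x \<otimes> y \<in> K) \<and> (\<forall>x\<in>K - {\<zero>}. inv x \<in> K)"

definition left_subspace :: "'a set \<Rightarrow> 'a set \<Rightarrow> bool" where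
  "left_subspace K V \<longleftrightarrow> V \<subseteq> carrier R \<and> \<zero> \<in> V \<and>
    (\<forall>x\<in>V. \<forall>y\<in>V. x \<oplus> y \<in> V) \<and> (\<forall>k\<in>K. \<forall>x\<in>V. k \<otimes> x \<in> V)"

lemma division_subring_closed:
  assumes "division_subring K"
  shows "\<zero> \<in> K" "x \<in> K \<Longrightarrow> \<ominus> x \<in> K" "x \<in> K \<Longrightarrow> y \<in> K \<Longrightarrow> x \<oplus> y \<in> K"
proof -
  have K: "K \<subseteq> carrier R" "\<one> \<in> K" "\<And>x y. x \<in> K \<Longrightarrow> y \<in> K \<Longrightarrow> x \<ominus> y \<in> K"
    using assms unfolding division_subring_def by auto
  show zero: "\<zero> \<in> K" using K(3)[OF K(2,2)] by (simp add: minus_eq r_neg)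
  show neg: "\<ominus> x \<in> K" if "x \<in> K" for x
    using K(3)[OF zero that] that K(1) by (auto simp: minus_eq)
  show "x \<oplus> y \<in> K" if "x \<in> K" "y \<in> K"
    using K(3)[OF that(1) neg[OF that(2)]] that K(1) by (auto simp: minus_eq)
qed

lemma left_subspace_diff:
  assumes "division_subring K" "left_subspace K V" "x \<in> V" "y \<in> V"
  shows "x \<ominus> y \<in> V"
proof -
  have c: "x \<in> carrier R" "y \<in> carrier R" using assms unfolding left_subspace_def by auto
  have "\<ominus> \<one> \<in> K"
    using division_subring_closed(2)[OF assms(1)] assms(1) unfolding division_subring_def by blast
  then have "\<ominus> \<one> \<otimes> y \<in> V" using assms unfolding left_subspace_def by blast
  moreover have "\<ominus> \<one> \<otimes> y = \<ominus> y" using c by (simp add: l_minus)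
  ultimately have "x \<oplus> \<ominus> y \<in> V" using assms unfolding left_subspace_def by auto
  then show ?thesis by (simp add: minus_eq)
qed

text \<open>Dimension without bases: take a largest \<open>W\<close> among the subspaces of
  \<open>V\<close> whose size is a power of \<open>card K\<close>. A vector \<open>v\<close> outside
  \<open>W\<close> would give the larger subspace W + Kv, of size
  \<open>card W * card K\<close>.\<close>

lemma card_left_subspace:
  assumes K: "division_subring K" and V: "left_subspace K V"
  obtains n where "card V = card K ^ n"
proof -
  define S where "S = {W. W \<subseteq> V \<and> left_subspace K W \<and> (\<exists>n. card W = card K ^ n)}"
  have KR: "K \<subseteq> carrier R" and K1: "\<one> \<in> K" using K unfolding division_subring_def by auto
  have VR: "V \<subseteq> carrier R" using V unfolding left_subspace_def by auto
  have finV: "finite V" and finK: "finite K" using VR KR finite_carrier finite_subset by auto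
  have "{\<zero>} \<in> S"
    using V KR unfolding S_def left_subspace_def by (auto intro: exI[of _ 0])
  moreover have "finite S" unfolding S_def using finV by auto
  ultimately have "Max (card ` S) \<in> card ` S" by (intro Max_in) auto
  then obtain W where W: "W \<in> S" "card W = Max (card ` S)" by (metis imageE)
  then have max: "\<And>W'. W' \<in> S \<Longrightarrow> card W' \<le> card W" using \<open>finite S\<close> by simp
  show ?thesis
  proof (cases "W = V")
    case True
    then show ?thesis using W(1) that unfolding S_def by auto
  next
    case False
    then obtain v where v: "v \<in> V" "v \<notin> W" using W unfolding S_def by auto
    have Ws: "left_subspace K W" "W \<subseteq> V" using W unfolding S_def by auto
    have vR: "v \<in> carrier R" using v VR by auto
    have WR: "W \<subseteq> carrier R" using Ws VR by auto
    define h where "h = (\<lambda>(w, k). w \<oplus> k \<otimes> v)"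
    \<comment> \<open>The form w + kv is unique: if two coefficients of \<open>v\<close> differed,
      dividing by their difference would put \<open>v\<close> into \<open>W\<close>.\<close>
    have inj: "inj_on h (W \<times> K)"
    proof (rule inj_onI, clarify)
      fix w k w' k' assume A: "w \<in> W" "k \<in> K" "w' \<in> W" "k' \<in> K" "h (w, k) = h (w', k')"
      have cc: "w \<in> carrier R" "w' \<in> carrier R" "k \<in> carrier R" "k' \<in> carrier R" using A WR KR by auto
      have "(k \<ominus> k') \<otimes> v = (w \<oplus> k \<otimes> v) \<ominus> w \<ominus> k' \<otimes> v"
        using cc vR by algebra
      also have "w \<oplus> k \<otimes> v = w' \<oplus> k' \<otimes> v" using A(5) unfolding h_def by simp
      also have "\<dots> \<ominus> w \<ominus> k' \<otimes> v = w' \<ominus> w"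
        using cc vR by algebra
      finally have e: "(k \<ominus> k') \<otimes> v = w' \<ominus> w" .
      show "w = w' \<and> k = k'"
      proof (cases "k \<ominus> k' = \<zero>")
        case True
        note True
        moreover have "k = (k \<ominus> k') \<oplus> k'" using cc by algebra
        ultimately have "k = k'" using cc by simp
        have "w' \<ominus> w = \<zero>" using e True vR by simp
        moreover have "w' = (w' \<ominus> w) \<oplus> w" using cc by algebra
        ultimately have "w' = w" using cc by simp
        with \<open>k = k'\<close> show ?thesis by simp
      next
        case False
        have kk: "k \<ominus> k' \<in> K" using A K unfolding division_subring_def by blast
        then have i: "inv (k \<ominus> k') \<in> K" using False K unfolding division_subring_def by blast
        have u: "k \<ominus> k' \<in> Units R" using kk KR False Units_eq by auto
        have "w' \<ominus> w \<in> W" using left_subspace_diff[OF K Ws(1)] A by auto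
        then have "inv (k \<ominus> k') \<otimes> ((k \<ominus> k') \<otimes> v) \<in> W"
          unfolding e using i Ws(1) unfolding left_subspace_def by auto
        moreover have "inv (k \<ominus> k') \<otimes> ((k \<ominus> k') \<otimes> v) = v"
          using u vR by (metis Units_closed Units_inv_closed Units_l_inv l_one m_assoc)
        ultimately show ?thesis using v by simp
      qed
    qed
    let ?W' = "h ` (W \<times> K)"
    have "card ?W' = card W * card K" using inj by (simp add: card_image card_cartesian_product)
    moreover obtain n where "card W = card K ^ n" using W(1) unfolding S_def by auto
    ultimately have c': "card ?W' = card K ^ Suc n" by simp
    have "left_subspace K ?W'"
      unfolding left_subspace_def
    proof (intro conjI ballI)
      show "?W' \<subseteq> carrier R" using WR KR vR unfolding h_def by auto
      have "h (\<zero>, \<zero>) \<in> ?W'"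
        using Ws(1) division_subring_closed(1)[OF K] unfolding left_subspace_def by blast
      then show "\<zero> \<in> ?W'" unfolding h_def using vR by simp
    next
      fix x y assume "x \<in> ?W'" "y \<in> ?W'"
      then obtain w k w' k' where A: "w \<in> W" "k \<in> K" "w' \<in> W" "k' \<in> K" "x = w \<oplus> k \<otimes> v" "y = w' \<oplus> k' \<otimes> v"
        unfolding h_def by auto
      have cc: "w \<in> carrier R" "w' \<in> carrier R" "k \<in> carrier R" "k' \<in> carrier R" using A WR KR by auto
      have "k \<oplus> k' \<in> K" using division_subring_closed(3)[OF K] A by blast
      moreover have "w \<oplus> w' \<in> W" using A Ws(1) unfolding left_subspace_def by auto
      moreover have "x \<oplus> y = (w \<oplus> w') \<oplus> (k \<oplus> k') \<otimes> v" unfolding A using cc vR by algebra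
      ultimately show "x \<oplus> y \<in> ?W'" unfolding h_def by force
    next
      fix k x assume "k \<in> K" "x \<in> ?W'"
      then obtain w k' where A: "w \<in> W" "k \<in> K" "k' \<in> K" "x = w \<oplus> k' \<otimes> v"
        unfolding h_def by auto
      have cc: "w \<in> carrier R" "k \<in> carrier R" "k' \<in> carrier R" using A WR KR by auto
      have "k \<otimes> w \<in> W" using A Ws(1) unfolding left_subspace_def by auto
      moreover have "k \<otimes> k' \<in> K" using A K unfolding division_subring_def by auto
      moreover have "k \<otimes> x = k \<otimes> w \<oplus> (k \<otimes> k') \<otimes> v" unfolding A using cc vR by algebra
      ultimately show "k \<otimes> x \<in> ?W'" unfolding h_def by force
    qed
    moreover have "?W' \<subseteq> V"
      using Ws(2) V v(1) unfolding left_subspace_def h_def by auto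
    ultimately have "?W' \<in> S" using c' unfolding S_def by blast
    then have "card W * card K \<le> card W" using max \<open>card ?W' = card W * card K\<close> by metis
    moreover have "card W > 0"
      using Ws finV unfolding left_subspace_def by (metis card_gt_0_iff empty_iff finite_subset)
    \<comment> \<open>Maximality of \<open>W\<close> leaves only \<open>K = {\<one>}\<close>; as K
      contains zero, the ring is then trivial and \<open>v\<close> is the zero vector, which lies in
      \<open>W\<close>.\<close>
    ultimately have "card K \<le> 1" by simp
    then have "K = {\<one>}" using K1 finK by (metis card_le_Suc0_iff_eq One_nat_def singletonI insert_absorb is_singletonI' is_singleton_def empty_iff)
    then have "\<one> = \<zero>" using division_subring_closed(1)[OF K] by auto
    then have "v = \<zero>" using vR by (metis l_null l_one)
    then show ?thesis using v Ws unfolding left_subspace_def by auto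
  qed
qed

lemma division_subring_centralizer:
  assumes x: "x \<in> carrier R"
  shows "division_subring (centralizer R x)"
proof -
  have "inv y \<in> centralizer R x" if "y \<in> centralizer R x" "y \<noteq> \<zero>" for y
  proof -
    have y: "y \<in> carrier R" "y \<otimes> x = x \<otimes> y" using that unfolding centralizer_def by auto
    have u: "y \<in> Units R" using y that Units_eq by auto
    then have i: "inv y \<in> carrier R" by simp
    have "inv y \<otimes> x = inv y \<otimes> (x \<otimes> (y \<otimes> inv y))" using u x by simp
    also have "\<dots> = inv y \<otimes> (y \<otimes> x) \<otimes> inv y" using y i x by (simp add: m_assoc)
    also have "inv y \<otimes> (y \<otimes> x) = x"
      using u x y by (metis Units_inv_closed Units_l_inv l_one m_assoc)
    finally show ?thesis using i unfolding centralizer_def by simp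
  qed
  moreover have "y \<ominus> z \<in> centralizer R x \<and> y \<otimes> z \<in> centralizer R x"
    if "y \<in> centralizer R x" "z \<in> centralizer R x" for y z
  proof -
    have y: "y \<in> carrier R" "y \<otimes> x = x \<otimes> y" and z: "z \<in> carrier R" "z \<otimes> x = x \<otimes> z"
      using that unfolding centralizer_def by auto
    have "(y \<ominus> z) \<otimes> x = x \<otimes> (y \<ominus> z)"
      using x y z by (simp add: minus_eq l_distr r_distr l_minus r_minus)
    moreover have "y \<otimes> z \<otimes> x = x \<otimes> (y \<otimes> z)"
      using x y z by (metis m_assoc)
    ultimately show ?thesis using y z unfolding centralizer_def by simp
  qed
  ultimately show ?thesis
    using x unfolding division_subring_def by (auto simp: centralizer_def)
qed

lemma division_subring_Inter:
  assumes "\<K> \<noteq> {}" "\<And>K. K \<in> \<K> \<Longrightarrow> division_subring K"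
  shows "division_subring (\<Inter>\<K>)"
  using assms unfolding division_subring_def by blast

lemma centre_eq_Inter: "centre R = \<Inter> (centralizer R ` carrier R)"
  unfolding centre_def centralizer_def by (auto intro: zero_closed)

lemma division_subring_centre: "division_subring (centre R)"
  unfolding centre_eq_Inter
  using division_subring_centralizer by (intro division_subring_Inter) auto

lemma left_subspaceI:
  assumes "division_subring K" "division_subring V" "K \<subseteq> V"
  shows "left_subspace K V"
proof -
  show ?thesis
    using assms division_subring_closed[OF assms(2)]
    unfolding left_subspace_def division_subring_def by blast
qed

text \<open>Over its centre of order q the ring has q^n elements. If n > 1, each noncentral element
  has a centralizer of q^d elements with d a proper divisor of n, so the class equation of the unit
  group makes \<open>c\<close> divide q - 1, against the choice of \<open>c\<close>.\<close>

theorem wedderburn: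
  assumes "x \<in> carrier R" "y \<in> carrier R"
  shows "x \<otimes> y = y \<otimes> x"
proof (cases "\<one> = \<zero>")
  case True
  then show ?thesis using assms by (metis l_one l_null)
next
  case one: False
  define q where "q = card (centre R)"
  have ZR: "centre R \<subseteq> carrier R" unfolding centre_def by auto
  have Z01: "\<zero> \<in> centre R" "\<one> \<in> centre R" unfolding centre_def by auto
  have finZ: "finite (centre R)" using ZR finite_carrier finite_subset by auto
  have q: "2 \<le> q"
    using card_mono[OF finZ, of "{\<zero>, \<one>}"] Z01 one unfolding q_def by auto
  have R: "division_subring (carrier R)"
    unfolding division_subring_def using Units_eq by (auto intro: Units_inv_closed)
  obtain n where n: "card (carrier R) = q ^ n"
    using card_left_subspace[OF division_subring_centre left_subspaceI[OF division_subring_centre R ZR]]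
    unfolding q_def by auto
  interpret U: group "units_of R" by (rule units_group)
  have Uc: "carrier (units_of R) = carrier R - {\<zero>}" by (simp add: units_of_carrier Units_eq)
  have Ucent: "centralizer (units_of R) x = centralizer R x - {\<zero>}" if "x \<in> carrier R" for x
    unfolding centralizer_def Uc units_of_mult by auto
  have Ucentre: "centre (units_of R) = centre R - {\<zero>}"
  proof -
    have "x \<otimes> \<zero> = \<zero> \<otimes> x" if "x \<in> carrier R" for x using that by simp
    then show ?thesis unfolding centre_def Uc units_of_mult by blast
  qed
  have oU: "int (Coset.order (units_of R)) = int q ^ n - 1"
    unfolding Coset.order_def Uc using finite_carrier n q by (simp add: of_nat_diff card_Diff_singleton)
  have "n = 1"
  proof (rule ccontr)
    assume "n \<noteq> 1"
    moreover have "n \<noteq> 0"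
    proof
      assume "n = 0"
      then have "card (carrier R) = 1" using n by simp
      then show False using one by (metis card_1_singletonE one_closed singletonD zero_closed)
    qed
    ultimately have "1 < n" by simp
    then obtain c where c: "c dvd int q ^ n - 1"
      "\<And>d. d dvd n \<Longrightarrow> d < n \<Longrightarrow> c * (int q ^ d - 1) dvd int q ^ n - 1"
      "\<not> c dvd int q - 1"
      using cyclotomic_value q by blast
    have "c dvd int (card (centre (units_of R)))"
    proof (rule U.dvd_card_centre)
      show "finite (carrier (units_of R))" using Uc finite_carrier by simp
      show "c dvd int (Coset.order (units_of R))" using oU c by simp
    next
      fix x assume "x \<in> carrier (units_of R)" "x \<notin> centre (units_of R)"
      then have x: "x \<in> carrier R" "x \<notin> centre R" using Uc Ucentre by auto
      let ?C = "centralizer R x"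
      have CR: "?C \<subseteq> carrier R" unfolding centralizer_def by auto
      have finC: "finite ?C" using CR finite_carrier finite_subset by auto
      have ZC: "centre R \<subseteq> ?C" using x unfolding centre_def centralizer_def by auto
      note C = division_subring_centralizer[OF x(1)]
      obtain d where d: "card ?C = q ^ d"
        using card_left_subspace[OF division_subring_centre left_subspaceI[OF division_subring_centre C ZC]]
        unfolding q_def by auto
      \<comment> \<open>The ring is also a space over the centralizer itself; comparing exponents of
        q shows that d divides n.\<close>
      obtain k where "card (carrier R) = card ?C ^ k"
        using card_left_subspace[OF C left_subspaceI[OF C R CR]] by auto
      then have "q ^ n = q ^ (d * k)" using n d by (simp add: power_mult)
      then have "n = d * k" using q by simp
      moreover have "\<exists>y\<in>carrier R. x \<otimes> y \<noteq> y \<otimes> x" using x unfolding centre_def by blast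
      then obtain y where "y \<in> carrier R" "y \<otimes> x \<noteq> x \<otimes> y" by metis
      then have "?C \<noteq> carrier R" unfolding centralizer_def by blast
      then have "q ^ d < q ^ n" using CR d n finite_carrier by (metis psubset_card_mono psubsetI)
      then have "d < n" using q by simp
      ultimately have "c * (int q ^ d - 1) dvd int q ^ n - 1" using c(2) by simp
      moreover have "\<zero> \<in> ?C" using x unfolding centralizer_def by auto
      then have "int (card (centralizer (units_of R) x)) = int q ^ d - 1"
        unfolding Ucent[OF x(1)] using finC d q by (simp add: of_nat_diff card_Diff_singleton)
      ultimately show "c * int (card (centralizer (units_of R) x)) dvd int (Coset.order (units_of R))"
        using oU by simp
    qed
    moreover have "int (card (centre (units_of R))) = int q - 1"
      unfolding Ucentre using Z01 finZ q by (simp add: of_nat_diff card_Diff_singleton q_def)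
    ultimately show False using c(3) by simp
  qed
  then have "centre R = carrier R"
    using n ZR finite_carrier unfolding q_def by (simp add: card_subset_eq)
  then show ?thesis using assms unfolding centre_def by blast
qed

end

section \<open>The division ring of a group partition\<close>

text \<open>Andre's model of a translation plane: \<open>V\<close> is the translation group and the
  components are the lines through the origin. The group is written multiplicatively, so its
  \<open>\<one>\<close> is the zero vector.\<close>

locale group_partition = comm_group V for V (structure) +
  fixes \<S> :: "'a set set"
  assumes finite_carrier: "finite (carrier V)"
    and component_subgroup: "H \<in> \<S> \<Longrightarrow> subgroup H V"
    and component_ex: "x \<in> carrier V \<Longrightarrow> \<exists>H\<in>\<S>. x \<in> H"
    and component_disjoint: "H \<in> \<S> \<Longrightarrow> K \<in> \<S> \<Longrightarrow> H \<noteq> K \<Longrightarrow> H \<inter> K = {\<one>}"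
    and component_proper: "H \<in> \<S> \<Longrightarrow> H \<noteq> carrier V"
begin

text \<open>The kernel of the partition. Restricting to \<open>extensional (carrier V)\<close> makes
  maps that agree on the group equal, as the ring laws demand, and keeps the carrier finite.\<close>

definition scalars :: "('a \<Rightarrow> 'a) ring" where
  "scalars = \<lparr>carrier = {f \<in> hom V V \<inter> extensional (carrier V). \<forall>H\<in>\<S>. f ` H \<subseteq> H},
    mult = compose (carrier V), one = (\<lambda>x\<in>carrier V. x),
    zero = (\<lambda>x\<in>carrier V. \<one>), add = (\<lambda>f g. \<lambda>x\<in>carrier V. f x \<otimes> g x)\<rparr>"

lemma scalarsD:
  assumes "f \<in> carrier scalars"
  shows "f \<in> extensional (carrier V)" "x \<in> carrier V \<Longrightarrow> f x \<in> carrier V"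
    "x \<in> carrier V \<Longrightarrow> y \<in> carrier V \<Longrightarrow> f (x \<otimes> y) = f x \<otimes> f y"
    "H \<in> \<S> \<Longrightarrow> x \<in> H \<Longrightarrow> f x \<in> H" "f \<one> = \<one>"
proof -
  have h: "f \<in> hom V V" using assms unfolding scalars_def by simp
  show "f \<in> extensional (carrier V)" "H \<in> \<S> \<Longrightarrow> x \<in> H \<Longrightarrow> f x \<in> H"
    using assms unfolding scalars_def by auto
  show "x \<in> carrier V \<Longrightarrow> f x \<in> carrier V"
    "x \<in> carrier V \<Longrightarrow> y \<in> carrier V \<Longrightarrow> f (x \<otimes> y) = f x \<otimes> f y"
    using h unfolding hom_def by auto
  show "f \<one> = \<one>" using hom_one[OF h] is_group by blast
qed

lemma scalarsI:
  assumes "\<And>x. x \<in> carrier V \<Longrightarrow> f x \<in> carrier V"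
    "\<And>x y. x \<in> carrier V \<Longrightarrow> y \<in> carrier V \<Longrightarrow> f (x \<otimes> y) = f x \<otimes> f y"
    "\<And>H x. H \<in> \<S> \<Longrightarrow> x \<in> H \<Longrightarrow> x \<in> carrier V \<Longrightarrow> f x \<in> H"
  shows "restrict f (carrier V) \<in> carrier scalars"
proof -
  have "H \<subseteq> carrier V" if "H \<in> \<S>" for H using component_subgroup[OF that] subgroup.subset by blast
  then show ?thesis using assms unfolding scalars_def hom_def by (auto simp: subset_eq)
qed

lemma scalars_simps:
  "\<one>\<^bsub>scalars\<^esub> = (\<lambda>x\<in>carrier V. x)" "\<zero>\<^bsub>scalars\<^esub> = (\<lambda>x\<in>carrier V. \<one>)"
  "f \<otimes>\<^bsub>scalars\<^esub> g = (\<lambda>x\<in>carrier V. f (g x))" "f \<oplus>\<^bsub>scalars\<^esub> g = (\<lambda>x\<in>carrier V. f x \<otimes> g x)"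
  unfolding scalars_def compose_def by simp_all

lemma scalars_eqI:
  assumes "f \<in> carrier scalars" "g \<in> carrier scalars" "\<And>x. x \<in> carrier V \<Longrightarrow> f x = g x"
  shows "f = g"
  using extensionalityI[OF scalarsD(1)[OF assms(1)] scalarsD(1)[OF assms(2)]] assms(3) by auto

lemma scalars_zero_closed: "\<zero>\<^bsub>scalars\<^esub> \<in> carrier scalars"
  unfolding scalars_simps
  by (rule scalarsI) (auto dest: component_subgroup subgroup.one_closed)

lemma scalars_one_closed: "\<one>\<^bsub>scalars\<^esub> \<in> carrier scalars"
  unfolding scalars_simps by (rule scalarsI) auto

lemma scalars_mult_closed:
  "f \<in> carrier scalars \<Longrightarrow> g \<in> carrier scalars \<Longrightarrow> f \<otimes>\<^bsub>scalars\<^esub> g \<in> carrier scalars"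
  unfolding scalars_simps by (rule scalarsI) (auto simp: scalarsD)

lemma scalars_add_closed:
  "f \<in> carrier scalars \<Longrightarrow> g \<in> carrier scalars \<Longrightarrow> f \<oplus>\<^bsub>scalars\<^esub> g \<in> carrier scalars"
  unfolding scalars_simps
  by (rule scalarsI) (auto simp: scalarsD m_ac intro: subgroup.m_closed[OF component_subgroup])

lemma scalars_uminus_closed:
  "f \<in> carrier scalars \<Longrightarrow> (\<lambda>x\<in>carrier V. inv (f x)) \<in> carrier scalars"
  by (rule scalarsI) (auto simp: scalarsD inv_mult intro: subgroup.m_inv_closed[OF component_subgroup])

lemma scalars_ring: "ring scalars"
proof (rule ringI)
  show "abelian_group scalars"
  proof (rule abelian_groupI)
    fix f assume f: "f \<in> carrier scalars"
    show "\<exists>g\<in>carrier scalars. g \<oplus>\<^bsub>scalars\<^esub> f = \<zero>\<^bsub>scalars\<^esub>"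
      using scalars_uminus_closed[OF f] scalarsD(2)[OF f]
      by (intro bexI[of _ "\<lambda>x\<in>carrier V. inv (f x)"]) (auto simp: scalars_simps)
    show "\<zero>\<^bsub>scalars\<^esub> \<oplus>\<^bsub>scalars\<^esub> f = f"
      by (rule scalars_eqI) (auto simp: f scalars_add_closed scalars_zero_closed, auto simp: scalars_simps scalarsD[OF f])
  qed (auto simp: scalars_add_closed scalars_zero_closed, auto simp: scalars_simps scalarsD m_ac)
  show "Group.monoid scalars"
  proof (rule monoidI)
    fix f assume f: "f \<in> carrier scalars"
    show "\<one>\<^bsub>scalars\<^esub> \<otimes>\<^bsub>scalars\<^esub> f = f"
      by (rule scalars_eqI) (auto simp: f scalars_mult_closed scalars_one_closed, auto simp: scalars_simps scalarsD[OF f])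
    show "f \<otimes>\<^bsub>scalars\<^esub> \<one>\<^bsub>scalars\<^esub> = f"
      by (rule scalars_eqI) (auto simp: f scalars_mult_closed scalars_one_closed, auto simp: scalars_simps scalarsD[OF f])
  qed (auto simp: scalars_mult_closed scalars_one_closed, auto simp: scalars_simps scalarsD)
qed (auto simp: scalars_simps scalarsD)

text \<open>If \<open>f\<close> kills \<open>x\<close>, then f y is also the image of
  \<open>x \<otimes> y\<close>, so it lies in the component of \<open>y\<close> and in that of
  \<open>x \<otimes> y\<close>. For \<open>y\<close> outside the component of \<open>x\<close> these
  two are different and share only the zero vector. For \<open>y\<close> inside it, some
  \<open>z\<close> outside takes over the role of \<open>x\<close>.\<close>

lemma scalar_zero_of_zero:
  assumes f: "f \<in> carrier scalars" and x: "x \<in> carrier V" "x \<noteq> \<one>" "f x = \<one>" and y: "y \<in> carrier V"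
  shows "f y = \<one>"
proof -
  have off: "f y = \<one>" if x: "x \<in> carrier V" "x \<noteq> \<one>" "f x = \<one>" and H: "H \<in> \<S>" "x \<in> H"
    and y: "y \<in> carrier V" "y \<notin> H" for x y H
  proof -
    obtain K where K: "K \<in> \<S>" "y \<in> K" using component_ex y by blast
    obtain M where M: "M \<in> \<S>" "x \<otimes> y \<in> M" using component_ex x y m_closed by blast
    have "M \<noteq> K"
    proof
      assume "M = K"
      then have "(x \<otimes> y) \<otimes> inv y \<in> K"
        using K M component_subgroup subgroup.m_closed subgroup.m_inv_closed by metis
      then have "x \<in> K" using x y by (simp add: m_assoc)
      then have "x \<in> H \<inter> K" "H \<noteq> K" using H K y by auto
      then show False using component_disjoint[OF H(1) K(1)] x by auto
    qed
    moreover have "f (x \<otimes> y) = f y" using scalarsD[OF f] x y by simp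
    then have "f y \<in> M" "f y \<in> K" using scalarsD(4)[OF f] M K by metis+
    ultimately show ?thesis using component_disjoint M K by blast
  qed
  obtain H where H: "H \<in> \<S>" "x \<in> H" using component_ex x by blast
  show ?thesis
  proof (cases "y \<in> H")
    case False
    then show ?thesis using off x H y by blast
  next
    case True
    have "H \<subseteq> carrier V" using subgroup.subset component_subgroup H by blast
    then obtain z where z: "z \<in> carrier V" "z \<notin> H" using component_proper[OF H(1)] by blast
    have fz: "f z = \<one>" using off x H z by blast
    have z1: "z \<noteq> \<one>" using z subgroup.one_closed[OF component_subgroup[OF H(1)]] by auto
    obtain K where K: "K \<in> \<S>" "z \<in> K" using component_ex z by blast
    then have "H \<inter> K = {\<one>}" using component_disjoint[OF H(1) K(1)] z by metis
    then show ?thesis using True off[OF z(1) z1 fz K y] scalarsD(5)[OF f] by (metis IntI singletonD)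
  qed
qed

text \<open>The difference of the two scalars kills \<open>x\<close>, hence everything. This is what
  allows an identity between scalars to be checked at one vertex of a hexagon.\<close>

lemma scalar_unique:
  assumes f: "f \<in> carrier scalars" and g: "g \<in> carrier scalars"
    and x: "x \<in> carrier V" "x \<noteq> \<one>" "f x = g x"
  shows "f = g"
proof (rule scalars_eqI[OF f g])
  let ?h = "f \<oplus>\<^bsub>scalars\<^esub> (\<lambda>x\<in>carrier V. inv (g x))"
  have h: "?h \<in> carrier scalars" using scalars_add_closed[OF f scalars_uminus_closed[OF g]] .
  have hx: "?h y = f y \<otimes> inv (g y)" if "y \<in> carrier V" for y using that by (simp add: scalars_simps)
  fix y assume y: "y \<in> carrier V"
  have "?h x = \<one>" using hx x scalarsD(2)[OF g] by simp
  then have "f y \<otimes> inv (g y) = \<one>" using scalar_zero_of_zero[OF h x(1,2) _ y] hx y by simp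
  then show "f y = g y" using scalarsD(2)[OF f y] scalarsD(2)[OF g y] by (metis inv_closed inv_equality inv_inv)
qed

text \<open>By \<open>scalar_zero_of_zero\<close> a scalar with nontrivial kernel is zero;
  finiteness then gives surjectivity.\<close>

lemma scalar_bij:
  assumes f: "f \<in> carrier scalars" "f \<noteq> \<zero>\<^bsub>scalars\<^esub>"
  shows "bij_betw f (carrier V) (carrier V)"
proof -
  obtain x where x: "x \<in> carrier V" "f x \<noteq> \<one>"
    using f scalars_eqI[OF f(1) scalars_zero_closed] by (auto simp: scalars_simps)
  have "inj_on f (carrier V)"
  proof (rule inj_onI)
    fix y z assume yz: "y \<in> carrier V" "z \<in> carrier V" "f y = f z"
    have "f (inv y) \<otimes> f y = \<one>" using yz scalarsD(3,5)[OF f(1)] by (metis inv_closed l_inv)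
    then have "f (inv y \<otimes> z) = \<one>" using yz scalarsD(3)[OF f(1)] by simp
    then have "inv y \<otimes> z = \<one>" using scalar_zero_of_zero[OF f(1), of "inv y \<otimes> z" x] x yz by auto
    then show "y = z" using yz by (metis inv_closed inv_equality inv_inv)
  qed
  moreover have "f ` carrier V \<subseteq> carrier V" using scalarsD(2)[OF f(1)] by blast
  ultimately show ?thesis using endo_inj_surj[OF finite_carrier] unfolding bij_betw_def by blast
qed

lemma scalars_division_ring: "finite_division_ring scalars"
proof -
  interpret R: ring scalars by (rule scalars_ring)
  show ?thesis
  proof
    have "carrier scalars \<subseteq> carrier V \<rightarrow>\<^sub>E carrier V"
      using scalarsD by (auto simp: PiE_def)
    then show "finite (carrier scalars)"
      using finite_PiE[OF finite_carrier, of "\<lambda>_. carrier V"] finite_carrier finite_subset by blast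
    have inv_ex: "\<exists>g\<in>carrier scalars. g \<otimes>\<^bsub>scalars\<^esub> f = \<one>\<^bsub>scalars\<^esub> \<and> f \<otimes>\<^bsub>scalars\<^esub> g = \<one>\<^bsub>scalars\<^esub>"
      if f: "f \<in> carrier scalars" "f \<noteq> \<zero>\<^bsub>scalars\<^esub>" for f
    proof -
      note b = scalar_bij[OF f]
      define g where "g = inv_into (carrier V) f"
      have gc: "g x \<in> carrier V" and fg: "f (g x) = x" if "x \<in> carrier V" for x
        using b that unfolding g_def bij_betw_def by (metis inv_into_into, metis f_inv_into_f)
      have gf: "g (f x) = x" if "x \<in> carrier V" for x
        using b that unfolding g_def bij_betw_def by (simp add: inv_into_f_f)
      have "restrict g (carrier V) \<in> carrier scalars"
      proof (rule scalarsI)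
        fix x y assume xy: "x \<in> carrier V" "y \<in> carrier V"
        have "f (g x \<otimes> g y) = x \<otimes> y" using xy gc fg scalarsD(3)[OF f(1)] by simp
        then show "g (x \<otimes> y) = g x \<otimes> g y" using gf xy gc by (metis m_closed)
      next
        fix H x assume H: "H \<in> \<S>" "x \<in> H" "x \<in> carrier V"
        have HV: "H \<subseteq> carrier V" using subgroup.subset component_subgroup H by blast
        \<comment> \<open>An injective map of the finite component into itself is onto, so the
          inverse preserves the component too.\<close>
        have "f ` H = H"
          using endo_inj_surj[of H f] scalarsD(4)[OF f(1) H(1)] HV finite_carrier b
          unfolding bij_betw_def by (meson finite_subset image_subsetI inj_on_subset)
        then obtain y where "y \<in> H" "f y = x" using H by (metis imageE)
        then show "g x \<in> H" using gf HV by auto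
      qed (use gc in auto)
      then show ?thesis
        using gc fg gf scalarsD(2)[OF f(1)] by (auto simp: scalars_simps intro!: bexI[of _ "restrict g (carrier V)"])
    qed
    have "\<one>\<^bsub>scalars\<^esub> \<noteq> \<zero>\<^bsub>scalars\<^esub>"
    proof
      assume e: "\<one>\<^bsub>scalars\<^esub> = \<zero>\<^bsub>scalars\<^esub>"
      then have one: "x = \<one>" if "x \<in> carrier V" for x
        using that fun_cong[OF e[unfolded scalars_simps], of x] by (metis restrict_apply')
      obtain H where H: "H \<in> \<S>" using component_ex by blast
      have "H = carrier V"
        using one subgroup.one_closed[OF component_subgroup[OF H]] subgroup.subset[OF component_subgroup[OF H]] by blast
      then show False using component_proper[OF H] by simp
    qed
    then have "\<zero>\<^bsub>scalars\<^esub> \<notin> Units scalars"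
      unfolding Units_def by auto
    moreover have "f \<in> Units scalars" if "f \<in> carrier scalars" "f \<noteq> \<zero>\<^bsub>scalars\<^esub>" for f
      using inv_ex[OF that] that unfolding Units_def by blast
    ultimately show "Units scalars = carrier scalars - {\<zero>\<^bsub>scalars\<^esub>}"
      by (auto simp: Units_def)
  qed
qed

theorem scalars_commute:
  assumes "f \<in> carrier scalars" "g \<in> carrier scalars" "x \<in> carrier V"
  shows "f (g x) = g (f x)"
  using fun_cong[OF finite_division_ring.wedderburn[OF scalars_division_ring assms(1,2)], of x] assms(3)
  by (simp add: scalars_simps)

end

section \<open>Dilatations from Desargues' axiom\<close>

context affine_plane
begin

abbreviation join :: "'a \<Rightarrow> 'a \<Rightarrow> 'a set" where
  "join \<equiv> line_through L"

lemma line_point: "l \<in> L \<Longrightarrow> X \<in> l \<Longrightarrow> X \<in> Pts"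
  using lines_subset by blast

lemma line_unique: "l \<in> L \<Longrightarrow> m \<in> L \<Longrightarrow> X \<in> l \<Longrightarrow> Y \<in> l \<Longrightarrow> X \<in> m \<Longrightarrow> Y \<in> m \<Longrightarrow> X \<noteq> Y \<Longrightarrow> l = m"
  using line_through_eq by metis

lemma join_commute: "join X Y = join Y X"
  unfolding line_through_def by (simp add: conj_commute)

lemma parallel_sym: "parallel l m \<Longrightarrow> parallel m l"
  unfolding parallel_def by auto

lemma parallel_trans:
  assumes "l \<in> L" "m \<in> L" "n \<in> L" "parallel l m" "parallel m n"
  shows "parallel l n"
proof (rule ccontr)
  assume "\<not> parallel l n"
  then obtain X where X: "X \<in> l" "X \<in> n" "l \<noteq> n" unfolding parallel_def by auto
  then have "X \<notin> m" using assms unfolding parallel_def by auto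
  then have "\<exists>!k. k \<in> L \<and> X \<in> k \<and> k \<inter> m = {}" using parallel_unique assms X line_point by blast
  then show False using assms X \<open>X \<notin> m\<close> unfolding parallel_def by blast
qed

lemma parallel_eq: "parallel l m \<Longrightarrow> X \<in> l \<Longrightarrow> X \<in> m \<Longrightarrow> l = m"
  unfolding parallel_def by auto

text \<open>Statements of the form \<open>Y \<in> par l X\<close> take the place of parallel joins
  below, because they keep their meaning for X = Y, where \<open>join X Y\<close> is
  undetermined.\<close>

definition par :: "'a set \<Rightarrow> 'a \<Rightarrow> 'a set" where
  "par l X = (THE m. m \<in> L \<and> X \<in> m \<and> parallel m l)"

lemma par_ex1:
  assumes "l \<in> L" "X \<in> Pts"
  shows "\<exists>!m. m \<in> L \<and> X \<in> m \<and> parallel m l"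
proof (cases "X \<in> l")
  case True
  then show ?thesis using assms unfolding parallel_def by blast
next
  case False
  then show ?thesis using parallel_unique[OF assms False] unfolding parallel_def by metis
qed

lemma par:
  assumes "l \<in> L" "X \<in> Pts"
  shows "par l X \<in> L" "X \<in> par l X" "parallel (par l X) l"
  using theI'[OF par_ex1[OF assms]] unfolding par_def by auto

lemma par_eqI: "l \<in> L \<Longrightarrow> m \<in> L \<Longrightarrow> X \<in> m \<Longrightarrow> parallel m l \<Longrightarrow> par l X = m"
  using par_ex1[of l X] par[of l X] line_point by blast

lemma par_self: "l \<in> L \<Longrightarrow> X \<in> l \<Longrightarrow> par l X = l"
  by (rule par_eqI) (auto simp: parallel_def)

lemma par_mem_eq: "l \<in> L \<Longrightarrow> X \<in> Pts \<Longrightarrow> Y \<in> par l X \<Longrightarrow> par l Y = par l X"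
  using par par_eqI by blast

lemma par_mem_sym: "l \<in> L \<Longrightarrow> X \<in> Pts \<Longrightarrow> Y \<in> par l X \<Longrightarrow> X \<in> par l Y"
  using par par_mem_eq by metis

lemma par_cong: "l \<in> L \<Longrightarrow> m \<in> L \<Longrightarrow> parallel l m \<Longrightarrow> X \<in> Pts \<Longrightarrow> par l X = par m X"
  using par par_eqI parallel_trans by metis

lemma par_par: "l \<in> L \<Longrightarrow> X \<in> Pts \<Longrightarrow> Y \<in> Pts \<Longrightarrow> par (par l X) Y = par l Y"
  using par par_cong by blast

lemma meet_ex:
  assumes "l \<in> L" "m \<in> L" "\<not> parallel l m"
  obtains X where "X \<in> l" "X \<in> m"
  using assms unfolding parallel_def by auto

lemma meet_unique: "l \<in> L \<Longrightarrow> m \<in> L \<Longrightarrow> \<not> parallel l m \<Longrightarrow> X \<in> l \<Longrightarrow> X \<in> m \<Longrightarrow> Y \<in> l \<Longrightarrow> Y \<in> m \<Longrightarrow> X = Y"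
  using line_unique unfolding parallel_def by blast

lemma off_line:
  assumes "l \<in> L"
  obtains X where "X \<in> Pts" "X \<notin> l"
  using three_points assms unfolding collinear3_def by blast

text \<open>The axioms do not exclude short lines outright. An empty line is parallel to every line,
  so only one line would pass through \<open>Y\<close>. A line consisting of \<open>X\<close> alone
  would leave a single line through \<open>Y\<close> that avoids \<open>X\<close>; but for
  \<open>Z\<close> off the join of X and Y, both \<open>join Y Z\<close> and the parallel to
  \<open>join X Z\<close> through \<open>Y\<close> avoid \<open>X\<close>.\<close>

lemma other_point:
  assumes l: "l \<in> L" and X: "X \<in> Pts"
  obtains Y where "Y \<in> l" "Y \<noteq> X"
proof (rule ccontr)
  assume "\<not> thesis"
  then have sub: "l \<subseteq> {X}" using that by auto
  obtain Y where Y: "Y \<in> Pts" "Y \<notin> l" using off_line l by blast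
  show False
  proof (cases "l = {}")
    case True
    have "\<And>m. m \<in> L \<Longrightarrow> Y \<in> m \<Longrightarrow> m = par l Y"
      using par_eqI l True unfolding parallel_def by (metis inf_bot_right)
    then have u: "m = n" if "m \<in> L" "Y \<in> m" "n \<in> L" "Y \<in> n" for m n using that by metis
    have "par l Y \<in> L" "Y \<in> par l Y" using par l Y by auto
    then obtain Z where Z: "Z \<in> Pts" "Z \<notin> par l Y" using off_line by blast
    then have "Y \<noteq> Z" using \<open>Y \<in> par l Y\<close> by auto
    then have "join Y Z \<in> L" "Y \<in> join Y Z" "Z \<in> join Y Z" using line_through Y Z by auto
    then show False using u Z \<open>par l Y \<in> L\<close> \<open>Y \<in> par l Y\<close> by metis
  next
    case False
    then have lX: "l = {X}" using sub by auto
    have YX: "Y \<noteq> X" using Y lX by auto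
    let ?n = "par l Y"
    have n: "?n \<in> L" "Y \<in> ?n" "X \<notin> ?n"
      using par[OF l Y(1)] Y lX unfolding parallel_def by auto
    have n1: "m = ?n" if "m \<in> L" "Y \<in> m" "X \<notin> m" for m
      using par_eqI[OF l that(1,2)] that lX unfolding parallel_def by auto
    obtain Z where Z: "Z \<in> Pts" "Z \<notin> join X Y" using off_line line_through[OF X Y(1)] YX by metis
    have XY: "join X Y \<in> L" "X \<in> join X Y" "Y \<in> join X Y" using line_through[OF X Y(1)] YX by auto
    have "Z \<noteq> X" "Z \<noteq> Y" using Z XY by auto
    then have YZ: "join Y Z \<in> L" "Y \<in> join Y Z" "Z \<in> join Y Z" using line_through[OF Y(1) Z(1)] by auto
    have "X \<notin> join Y Z" using line_unique[OF YZ(1) XY(1), of X Y] YZ XY Z YX by metis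
    have XZ: "join X Z \<in> L" "X \<in> join X Z" "Z \<in> join X Z" using line_through[OF X Z(1)] \<open>Z \<noteq> X\<close> by auto
    have "Y \<notin> join X Z" using line_unique[OF XZ(1) XY(1), of X Y] XZ XY Z YX by metis
    let ?p = "par (join X Z) Y"
    have p: "?p \<in> L" "Y \<in> ?p" "parallel ?p (join X Z)" using par XZ Y by auto
    then have "X \<notin> ?p" "Z \<notin> ?p" using XZ \<open>Y \<notin> join X Z\<close> parallel_eq by metis+
    then have "?p = ?n" using n1 p by blast
    moreover have "join Y Z = ?n" using n1 YZ \<open>X \<notin> join Y Z\<close> by blast
    ultimately show False using YZ \<open>Z \<notin> ?p\<close> by simp
  qed
qed

end

text \<open>Treats a parallel class and the lines through a point together: \<open>S\<close> holds
  the common points, none or one, and \<open>lam X\<close> is the member of the pencil through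
  \<open>X\<close>, determined only off \<open>S\<close>. The assumption \<open>carriers\<close>
  provides what Desargues' axiom requires of its three carrier lines.\<close>

locale pencil = desargues_affine_plane Pts L for Pts :: "'a set" and L +
  fixes S :: "'a set" and lam :: "'a \<Rightarrow> 'a set"
  assumes S_subset: "S \<subseteq> Pts"
    and S_unique: "X \<in> S \<Longrightarrow> Y \<in> S \<Longrightarrow> X = Y"
    and lam: "X \<in> Pts - S \<Longrightarrow> lam X \<in> L" "X \<in> Pts - S \<Longrightarrow> X \<in> lam X" "X \<in> Pts - S \<Longrightarrow> S \<subseteq> lam X"
    and lam_eq: "X \<in> Pts - S \<Longrightarrow> Y \<in> lam X - S \<Longrightarrow> lam Y = lam X"
    and carriers: "A \<in> Pts - S \<Longrightarrow> B \<in> Pts - S \<Longrightarrow> C \<in> Pts - S \<Longrightarrow>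
      lam A \<noteq> lam B \<Longrightarrow> lam B \<noteq> lam C \<Longrightarrow> lam A \<noteq> lam C \<Longrightarrow>
      parallel (lam A) (lam B) \<and> parallel (lam B) (lam C) \<or> (\<exists>Z. lam A \<inter> lam B \<inter> lam C = {Z} \<and> S = {Z})"
    and third: "A \<in> Pts - S \<Longrightarrow> B \<in> Pts - S \<Longrightarrow> \<exists>C\<in>Pts - S. lam C \<noteq> lam A \<and> lam C \<noteq> lam B"
begin

text \<open>\<open>X'\<close> is the only possible image of \<open>X\<close> under a dilatation that
  preserves the lines of the pencil and takes \<open>A\<close> to \<open>A'\<close>. For
  \<open>X\<close> on the line of \<open>A\<close> the parallel coincides with \<open>lam X\<close>
  and singles out no point, hence the condition \<open>lam A \<noteq> lam X\<close>.\<close>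

definition rel :: "'a \<Rightarrow> 'a \<Rightarrow> 'a \<Rightarrow> 'a \<Rightarrow> bool" where
  "rel A A' X X' \<longleftrightarrow> A \<in> Pts - S \<and> X \<in> Pts - S \<and> lam A \<noteq> lam X \<and>
    A' \<in> lam A - S \<and> X' \<in> lam X - S \<and> X' \<in> par (join A X) A'"

lemma lam_point: "X \<in> Pts - S \<Longrightarrow> X' \<in> lam X - S \<Longrightarrow> X' \<in> Pts - S"
  using lam line_point by blast

lemma rel_join:
  assumes "A \<in> Pts - S" "X \<in> Pts - S" "lam A \<noteq> lam X"
  shows "A \<noteq> X" "join A X \<in> L" "A \<in> join A X" "X \<in> join A X" "join A X \<noteq> lam A" "join A X \<noteq> lam X"
    "A \<notin> lam X" "X \<notin> lam A"
proof -
  show "A \<noteq> X" using assms by auto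
  then show "join A X \<in> L" "A \<in> join A X" "X \<in> join A X" using assms line_through by auto
  show "A \<notin> lam X" "X \<notin> lam A" using assms lam_eq by blast+
  then show "join A X \<noteq> lam A" "join A X \<noteq> lam X" using \<open>A \<in> join A X\<close> \<open>X \<in> join A X\<close> by auto
qed

lemma rel_sym:
  assumes "rel A A' X X'"
  shows "rel X X' A A'"
proof -
  have "A \<in> Pts - S" "X \<in> Pts - S" "lam A \<noteq> lam X" "A' \<in> Pts - S"
    using assms lam_point unfolding rel_def by auto
  then show ?thesis using assms par_mem_sym rel_join(2) join_commute unfolding rel_def by (metis DiffD1)
qed

lemma rel_ex:
  assumes "A \<in> Pts - S" "X \<in> Pts - S" "lam A \<noteq> lam X" "A' \<in> lam A - S"
  shows "\<exists>X'. rel A A' X X'"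
proof -
  note j = rel_join[OF assms(1-3)]
  let ?p = "par (join A X) A'"
  have A': "A' \<in> Pts" using assms lam_point by blast
  have p: "?p \<in> L" "A' \<in> ?p" "parallel ?p (join A X)" using par j A' by auto
  have "\<not> parallel ?p (lam X)"
    using parallel_trans[of "join A X" ?p "lam X"] p j lam assms parallel_sym parallel_eq[of "join A X" "lam X" X] by blast
  then obtain X' where X': "X' \<in> ?p" "X' \<in> lam X" using meet_ex p lam assms by blast
  have "X' \<notin> S"
  proof
    assume s: "X' \<in> S"
    then have "X' \<in> lam A" using lam assms by blast
    then have "?p = lam A" using line_unique[of ?p "lam A" X' A'] p lam assms X' s by blast
    then show False using p(3) parallel_eq[of "lam A" "join A X" A] j lam assms by auto
  qed
  then show ?thesis using assms X' unfolding rel_def by auto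
qed

lemma rel_unique:
  assumes "rel A A' X X'" "rel A A' X X''"
  shows "X' = X''"
proof -
  have a: "A \<in> Pts - S" "X \<in> Pts - S" "lam A \<noteq> lam X" "A' \<in> lam A - S" using assms unfolding rel_def by auto
  note j = rel_join[OF a(1-3)]
  let ?p = "par (join A X) A'"
  have A': "A' \<in> Pts" using a lam_point by blast
  have p: "?p \<in> L" "A' \<in> ?p" "parallel ?p (join A X)" using par j A' by auto
  have "\<not> parallel ?p (lam X)"
    using parallel_trans[of "join A X" ?p "lam X"] p j lam a parallel_sym parallel_eq[of "join A X" "lam X" X] by blast
  then show ?thesis using meet_unique[of ?p "lam X" X' X''] p lam a assms unfolding rel_def by auto
qed

lemma rel_THE:
  assumes "A \<in> Pts - S" "X \<in> Pts - S" "lam A \<noteq> lam X" "A' \<in> lam A - S"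
  shows "rel A A' X (THE X'. rel A A' X X')"
proof (rule theI')
  show "\<exists>!X'. rel A A' X X'" using rel_ex[OF assms] rel_unique by blast
qed

text \<open>Desargues' axiom for the vertices A, B, C and A', B', C'. Its side conditions hold
  because the three lines of the pencil are distinct and all six vertices avoid
  \<open>S\<close>.\<close>

lemma rel_trans:
  assumes AB: "rel A A' B B'" and BC: "rel B B' C C'" and AC: "lam A \<noteq> lam C"
  shows "rel A A' C C'"
proof -
  have p: "A \<in> Pts - S" "B \<in> Pts - S" "C \<in> Pts - S" "lam A \<noteq> lam B" "lam B \<noteq> lam C"
    and q: "A' \<in> lam A - S" "B' \<in> lam B - S" "C' \<in> lam C - S"
    using assms unfolding rel_def by auto
  have p': "A' \<in> Pts - S" "B' \<in> Pts - S" "C' \<in> Pts - S" using p q lam_point by auto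
  have l': "lam A' = lam A" "lam B' = lam B" "lam C' = lam C" using lam_eq p q by blast+
  have d': "lam A' \<noteq> lam B'" "lam B' \<noteq> lam C'" "lam A' \<noteq> lam C'" using l' p AC by auto
  note jAB = rel_join[OF p(1,2,4)] and jBC = rel_join[OF p(2,3,5)] and jAC = rel_join[OF p(1,3) AC]
  note jAB' = rel_join[OF p'(1,2) d'(1)] and jBC' = rel_join[OF p'(2,3) d'(2)] and jAC' = rel_join[OF p'(1,3) d'(3)]
  have e: "join X' Y' = par (join X Y) X'"
    if "rel X X' Y Y'" "join X Y \<in> L" "X' \<in> Pts - S" "X' \<noteq> Y'" for X X' Y Y'
    using that par[of "join X Y" X'] line_through_eq[of "par (join X Y) X'" X' Y'] unfolding rel_def by auto
  have 1: "parallel (join A B) (join A' B')"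
    using e[OF AB jAB(2) p'(1) jAB'(1)] par(3)[OF jAB(2)] p' parallel_sym by (metis DiffD1)
  have 2: "parallel (join B C) (join B' C')"
    using e[OF BC jBC(2) p'(2) jBC'(1)] par(3)[OF jBC(2)] p' parallel_sym by (metis DiffD1)
  have k: "parallel (lam A) (lam B) \<and> parallel (lam B) (lam C) \<or>
    (\<exists>Z. lam A \<inter> lam B \<inter> lam C = {Z} \<and> Z \<notin> {A, A', B, B', C, C'})"
    using carriers[OF p(1-5) AC] p p' by auto
  \<comment> \<open>The axiom asks for different lines \<open>join A C\<close> and
    \<open>join A' C'\<close>; equal ones are parallel anyway.\<close>
  have "parallel (join A C) (join A' C')"
  proof (cases "join A C = join A' C'")
    case True
    then show ?thesis unfolding parallel_def by simp
  next
    case False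
    then have d: "distinct [lam A, lam B, lam C, join A C, join A' C']"
      using p(4,5) AC jAB(7) jBC(8) jAC(3,4,5,6) jAC'(3,4,5,6) jAB'(7) jBC'(8) unfolding l'
      by (metis distinct_length_2_or_more distinct_singleton)
    have mem: "lam A \<in> L" "lam B \<in> L" "lam C \<in> L" "A \<in> lam A" "A' \<in> lam A" "B \<in> lam B" "B' \<in> lam B" "C \<in> lam C" "C' \<in> lam C"
      using p q lam by auto
    show ?thesis
      using desargues[unfolded desargues_axiom_def, rule_format, OF mem d k 1 2 jAC(1) jAC'(1)]
        jAB(6) jBC(5) by blast
  qed
  then have "par (join A C) A' = join A' C'"
    using par_eqI jAC jAC' parallel_sym by blast
  then show ?thesis using p q AC jAC' unfolding rel_def by auto
qed

text \<open>Images off the line of \<open>P\<close> are dictated by the pair \<open>P\<close>,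
  \<open>P'\<close>. On that line they are taken from an auxiliary pair \<open>A\<close>,
  \<open>A'\<close>, itself related to \<open>P\<close>, \<open>P'\<close>. All properties follow
  once \<open>rel X (f X) Y (f Y)\<close> holds for any two points on different lines of the
  pencil.\<close>

theorem exists_pencil_dilatation:
  assumes P: "P \<in> Pts - S" and P': "P' \<in> lam P - S"
  obtains f where "f P = P'" "\<And>X. X \<in> S \<Longrightarrow> f X = X" "\<And>X. X \<in> Pts - S \<Longrightarrow> f X \<in> lam X - S"
    "inj_on f Pts" "\<And>l X Y. l \<in> L \<Longrightarrow> X \<in> l \<Longrightarrow> Y \<in> l \<Longrightarrow> f Y \<in> par l (f X)"
proof -
  obtain A where A: "A \<in> Pts - S" "lam A \<noteq> lam P" using third[OF P P] by auto
  obtain A' where A': "rel P P' A A'" using rel_ex[OF P A(1) _ P'] A(2) by metis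
  have A'': "A' \<in> lam A - S" using A' unfolding rel_def by auto
  define f where "f = (\<lambda>X. if X \<in> S then X else if lam X = lam P then (THE X'. rel A A' X X') else (THE X'. rel P P' X X'))"
  have fS: "f X = X" if "X \<in> S" for X using that unfolding f_def by simp
  have fA: "rel A A' X (f X)" if "X \<in> Pts - S" "lam X = lam P" for X
    using rel_THE[OF A(1) that(1) _ A''] that A(2) unfolding f_def by auto
  have fP: "rel P P' X (f X)" if "X \<in> Pts - S" "lam X \<noteq> lam P" for X
    using rel_THE[OF P that(1) _ P'] that unfolding f_def by auto
  have fA': "f A = A'" using fP A A' rel_unique by blast
  \<comment> \<open>\<open>X\<close> got its image from \<open>A\<close> and \<open>Y\<close> from
    \<open>P\<close>. The passage through \<open>A\<close> requires \<open>Y\<close> off the line of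
    \<open>A\<close>, as \<open>rel_trans\<close> needs different lines; if \<open>Y\<close> is on
    it, a point \<open>C\<close> on a third line serves as intermediary.\<close>
  have mixed: "rel X (f X) Y (f Y)" if X: "X \<in> Pts - S" "lam X = lam P" and Y: "Y \<in> Pts - S" "lam Y \<noteq> lam P" for X Y
  proof (cases "lam Y = lam A")
    case False
    have "rel A A' Y (f Y)" using rel_trans[OF rel_sym[OF A'] fP[OF Y]] False by metis
    then show ?thesis using rel_trans[OF rel_sym[OF fA[OF X]]] X Y by metis
  next
    case True
    obtain C where C: "C \<in> Pts - S" "lam C \<noteq> lam A" "lam C \<noteq> lam P" using third A P by blast
    have "rel A A' C (f C)" using rel_trans[OF rel_sym[OF A'] fP[OF C(1,3)]] C by metis
    then have 1: "rel X (f X) C (f C)" using rel_trans[OF rel_sym[OF fA[OF X]]] X C by metis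
    have "rel C (f C) Y (f Y)" using rel_trans[OF rel_sym[OF fP[OF C(1,3)]] fP[OF Y]] C True by metis
    then show ?thesis using rel_trans[OF 1] X Y by metis
  qed
  have rel: "rel X (f X) Y (f Y)" if X: "X \<in> Pts - S" and Y: "Y \<in> Pts - S" and ne: "lam X \<noteq> lam Y" for X Y
  proof (cases "lam X = lam P")
    case True
    then show ?thesis using mixed X Y ne by metis
  next
    case False
    show ?thesis
    proof (cases "lam Y = lam P")
      case True
      then show ?thesis using mixed[OF Y True X False] rel_sym by blast
    next
      case f: False
      then show ?thesis using rel_trans[OF rel_sym[OF fP[OF X False]] fP[OF Y f] ne] by blast
    qed
  qed
  have fl: "f X \<in> lam X - S" if "X \<in> Pts - S" for X
    using fA fP that unfolding rel_def by metis
  show thesis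
  proof (rule that)
    show "f P = P'" using fA[OF P refl] rel_sym[OF A'] rel_unique by blast
    show "f X = X" if "X \<in> S" for X using fS that .
    show "f X \<in> lam X - S" if "X \<in> Pts - S" for X using fl that .
  next
    show "inj_on f Pts"
    proof (rule inj_onI)
      fix X Y assume X: "X \<in> Pts" and Y: "Y \<in> Pts" and e: "f X = f Y"
      show "X = Y"
      proof (cases "X \<in> S \<or> Y \<in> S")
        case True
        then show ?thesis using fl fS X Y e by (metis Diff_iff)
      next
        case False
        then have XY: "X \<in> Pts - S" "Y \<in> Pts - S" using X Y by auto
        have l: "lam X = lam Y" using fl[OF XY(1)] fl[OF XY(2)] lam_eq[OF XY(1)] lam_eq[OF XY(2)] e by metis
        obtain Z where Z: "Z \<in> Pts - S" "lam Z \<noteq> lam X" using third XY by blast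
        have 1: "rel Z (f Z) X (f X)" and 2: "rel Z (f Z) Y (f X)" using rel Z XY l e by metis+
        \<comment> \<open>Exchanging points and images turns \<open>rel\<close> into the relation
          for the inverse map, so \<open>rel_unique\<close> recovers a point from its image.\<close>
        have "rel (f Z) Z (f X) X" if "rel Z (f Z) X (f X)" "X \<in> Pts - S" "lam Z \<noteq> lam X" for X
        proof -
          have p: "f Z \<in> Pts - S" "f X \<in> Pts - S" and m: "lam (f Z) = lam Z" "lam (f X) = lam X"
            using fl that Z lam_point lam_eq by metis+
          note j = rel_join[OF Z(1) that(2,3)] and j' = rel_join[OF p]
          have "join (f Z) (f X) = par (join Z X) (f Z)"
            using that par[of "join Z X" "f Z"] p j j' m line_through_eq[of "par (join Z X) (f Z)" "f Z" "f X"]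
            unfolding rel_def by auto
          then have "par (join (f Z) (f X)) Z = par (join Z X) Z" using par_par j p Z by auto
          also have "\<dots> = join Z X" using par_self j by blast
          finally show ?thesis unfolding rel_def using p Z that j m lam by auto
        qed
        then have "rel (f Z) Z (f X) X" "rel (f Z) Z (f X) Y" using 1 2 XY Z l e by metis+
        then show ?thesis using rel_unique by blast
      qed
    qed
  next
    fix l X Y assume a: "l \<in> L" "X \<in> l" "Y \<in> l"
    have X: "X \<in> Pts" and Y: "Y \<in> Pts" using a line_point by auto
    have fPts: "f X \<in> Pts" using fl fS lam_point X by (metis DiffD1 DiffI)
    show "f Y \<in> par l (f X)"
    proof (cases "X = Y")
      case True
      then show ?thesis using par a fPts by auto
    next
      case ne: False
      have inl: "f Z \<in> lam W" if "Z \<in> lam W" "Z \<in> Pts" "W \<in> Pts - S" for Z W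
        using that fl[of Z] fS[of Z] lam_eq[of W Z] by (cases "Z \<in> S") auto
      \<comment> \<open>If \<open>l\<close> belongs to the pencil it is mapped into itself. This
        covers all cases in which \<open>rel\<close> does not apply to \<open>X\<close> and
        \<open>Y\<close>.\<close>
      have on: ?thesis if W: "W \<in> Pts - S" "X \<in> lam W" "Y \<in> lam W" for W
      proof -
        have "l = lam W" using line_unique a lam W ne by metis
        then show ?thesis using inl W X Y par_self a by auto
      qed
      show ?thesis
      proof (cases "X \<in> S \<or> Y \<in> S")
        case True
        then show ?thesis using on[of X] on[of Y] lam X Y ne S_unique by blast
      next
        case False
        show ?thesis
        proof (cases "lam X = lam Y")
          case True
          then show ?thesis using on[of X] lam X Y False by auto
        next
          case d: False
          then have "f Y \<in> par (join X Y) (f X)" using rel[of X Y] X Y False unfolding rel_def by auto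
          then show ?thesis using line_through_eq[of l X Y] a ne by simp
        qed
      qed
    qed
  qed
qed

end

section \<open>Translations and homotheties\<close>

context affine_plane
begin

text \<open>A dilatation expressed by \<open>par\<close>: each line goes into the parallel through
  the image of any of its points.\<close>

definition dil :: "('a \<Rightarrow> 'a) \<Rightarrow> bool" where
  "dil f \<longleftrightarrow> bij_betw f Pts Pts \<and> (\<forall>l\<in>L. \<forall>X\<in>l. \<forall>Y\<in>l. f Y \<in> par l (f X))"

text \<open>Tied to a direction rather than to the absence of fixed points, so that the identity is
  a translation along every line.\<close>

definition translation_along :: "'a set \<Rightarrow> ('a \<Rightarrow> 'a) \<Rightarrow> bool" where
  "translation_along l f \<longleftrightarrow> dil f \<and> (\<forall>X\<in>Pts. f X \<in> par l X)"

lemma dil_point: "dil f \<Longrightarrow> X \<in> Pts \<Longrightarrow> f X \<in> Pts"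
  unfolding dil_def bij_betw_def by auto

lemma dil_inj: "dil f \<Longrightarrow> X \<in> Pts \<Longrightarrow> Y \<in> Pts \<Longrightarrow> f X = f Y \<Longrightarrow> X = Y"
  unfolding dil_def bij_betw_def inj_on_def by auto

lemma dil_surj: "dil f \<Longrightarrow> Y \<in> Pts \<Longrightarrow> \<exists>X\<in>Pts. f X = Y"
  unfolding dil_def bij_betw_def by (metis imageE)

lemma dil_par:
  assumes "dil f" "l \<in> L" "X \<in> Pts" "Y \<in> par l X"
  shows "f Y \<in> par l (f X)"
proof -
  have "f Y \<in> par (par l X) (f X)" using assms par unfolding dil_def by blast
  then show ?thesis using par_par assms dil_point by metis
qed

lemma dil_par_iff:
  assumes f: "dil f" and l: "l \<in> L" and X: "X \<in> Pts" and Y: "Y \<in> Pts"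
  shows "f Y \<in> par l (f X) \<longleftrightarrow> Y \<in> par l X"
proof
  assume a: "f Y \<in> par l (f X)"
  show "Y \<in> par l X"
  proof (cases "X = Y")
    case True
    then show ?thesis using par l X by auto
  next
    case False
    let ?m = "join X Y"
    have m: "?m \<in> L" "X \<in> ?m" "Y \<in> ?m" using line_through X Y False by auto
    have fX: "f X \<in> Pts" using dil_point f X by auto
    have "f Y \<in> par ?m (f X)" using f m unfolding dil_def by blast
    moreover have "f X \<noteq> f Y" using dil_inj f X Y False by blast
    ultimately have "par ?m (f X) = par l (f X)"
      using a line_unique par[OF m(1) fX] par[OF l fX] by metis
    then have "par l X = par ?m X" using par_par[OF l fX X] par_par[OF m(1) fX X] by simp
    then show ?thesis using par_self m by auto
  qed
next
  show "Y \<in> par l X \<Longrightarrow> f Y \<in> par l (f X)" using dil_par[OF f l X] .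
qed

lemma dil_id: "dil (\<lambda>X. X)"
  unfolding dil_def using par_self by (auto simp: bij_betw_def)

lemma dil_comp:
  assumes "dil f" "dil g"
  shows "dil (f \<circ> g)"
proof -
  have "bij_betw (f \<circ> g) Pts Pts" using assms bij_betw_trans[of g Pts Pts f Pts] unfolding dil_def by simp
  moreover have "f (g Y) \<in> par l (f (g X))" if "l \<in> L" "X \<in> l" "Y \<in> l" for l X Y
  proof -
    have "g X \<in> Pts" using dil_point assms(2) line_point that by metis
    moreover have "g Y \<in> par l (g X)" using assms(2) that unfolding dil_def by blast
    ultimately show ?thesis using dil_par[OF assms(1) that(1)] by blast
  qed
  ultimately show ?thesis unfolding dil_def by auto
qed

lemma dil_inv:
  assumes f: "dil f"
  shows "dil (inv_into Pts f)" "X \<in> Pts \<Longrightarrow> inv_into Pts f (f X) = X" "X \<in> Pts \<Longrightarrow> f (inv_into Pts f X) = X"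
    "X \<in> Pts \<Longrightarrow> inv_into Pts f X \<in> Pts"
proof -
  let ?g = "inv_into Pts f"
  have b: "bij_betw f Pts Pts" using f unfolding dil_def by simp
  have g: "?g X \<in> Pts" "f (?g X) = X" if "X \<in> Pts" for X
    using b that unfolding bij_betw_def by (auto simp: inv_into_into f_inv_into_f)
  show "X \<in> Pts \<Longrightarrow> ?g (f X) = X" using b unfolding bij_betw_def by simp
  show "X \<in> Pts \<Longrightarrow> f (?g X) = X" "X \<in> Pts \<Longrightarrow> ?g X \<in> Pts" using g by auto
  have "?g Y \<in> par l (?g X)" if l: "l \<in> L" "X \<in> l" "Y \<in> l" for l X Y
  proof -
    have "X \<in> Pts" "Y \<in> Pts" using l line_point by auto
    then show ?thesis using dil_par_iff[OF f l(1), of "?g X" "?g Y"] g par_self l by metis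
  qed
  then show "dil ?g" unfolding dil_def using bij_betw_inv_into[OF b] by blast
qed

lemma dil_join:
  assumes "dil f" "X \<in> Pts" "f X \<noteq> X" "Y \<in> join X (f X)"
  shows "f Y \<in> join X (f X)"
proof -
  have l: "join X (f X) \<in> L" "X \<in> join X (f X)" "f X \<in> join X (f X)"
    using line_through assms dil_point by metis+
  then have "f Y \<in> par (join X (f X)) (f X)" using assms unfolding dil_def by blast
  then show ?thesis using par_self l by simp
qed

lemma translation_along_id: "l \<in> L \<Longrightarrow> translation_along l (\<lambda>X. X)"
  unfolding translation_along_def using dil_id par by auto

lemma translation_along_dil: "translation_along l f \<Longrightarrow> dil f"
  unfolding translation_along_def by simp

text \<open>For \<open>Y\<close> off the trace of \<open>X\<close>, the image of \<open>Y\<close> is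
  where the parallel to \<open>join X Y\<close> through f X meets the parallel to \<open>l\<close>
  through \<open>Y\<close>. A point on the trace is reached through some \<open>Z\<close> off
  it.\<close>

lemma translation_along_unique_same:
  assumes l: "l \<in> L" and f: "translation_along l f" and g: "translation_along l g"
    and X: "X \<in> Pts" "f X = g X" and Y: "Y \<in> Pts"
  shows "f Y = g Y"
proof -
  have off: "f Y = g Y" if X: "X \<in> Pts" "f X = g X" and Y: "Y \<in> Pts" "Y \<notin> par l X" for X Y
  proof -
    have "X \<noteq> Y" using par l X Y by auto
    then have m: "join X Y \<in> L" "X \<in> join X Y" "Y \<in> join X Y" using line_through X Y by auto
    have fX: "f X \<in> Pts" using dil_point f X translation_along_dil by blast
    let ?m = "par (join X Y) (f X)" and ?l = "par l Y"
    have "f Y \<in> ?m" "g Y \<in> ?m" using f g m X unfolding translation_along_def dil_def by metis+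
    moreover have "f Y \<in> ?l" "g Y \<in> ?l" using f g Y unfolding translation_along_def by auto
    moreover have "\<not> parallel ?m ?l"
    proof
      assume "parallel ?m ?l"
      then have "par ?m Y = par ?l Y" using par_cong par m l fX Y by metis
      then have "join X Y = par l Y" using par_par par_self m l fX Y by metis
      then show False using m par_mem_sym[OF l Y(1), of X] Y by simp
    qed
    ultimately show ?thesis using meet_unique par m l fX Y by metis
  qed
  show ?thesis
  proof (cases "Y \<in> par l X")
    case False
    then show ?thesis using off X Y by blast
  next
    case True
    obtain Z where Z: "Z \<in> Pts" "Z \<notin> par l X" using off_line par l X by blast
    then have "f Z = g Z" using off X by blast
    moreover have "Y \<notin> par l Z" using True Z par_mem_eq par_mem_sym l X Y by metis
    ultimately show ?thesis using off Z Y by blast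
  qed
qed

lemma translation_along_fixed:
  "l \<in> L \<Longrightarrow> translation_along l f \<Longrightarrow> X \<in> Pts \<Longrightarrow> f X = X \<Longrightarrow> Y \<in> Pts \<Longrightarrow> f Y = Y"
  using translation_along_unique_same translation_along_id by blast

definition is_translation :: "('a \<Rightarrow> 'a) \<Rightarrow> bool" where
  "is_translation f \<longleftrightarrow> (\<exists>l\<in>L. translation_along l f)"

lemma is_translation_dil: "is_translation f \<Longrightarrow> dil f"
  unfolding is_translation_def translation_along_def by auto

lemma is_translation_id: "is_translation (\<lambda>X. X)"
proof -
  obtain X where X: "X \<in> Pts" using points_nonempty by auto
  obtain P Q where "P \<in> Pts" "Q \<in> Pts" "P \<noteq> Q" using three_points by blast
  then have "join P Q \<in> L" using line_through by blast
  then show ?thesis unfolding is_translation_def using translation_along_id by blast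
qed

lemma translation_along_cong:
  "l \<in> L \<Longrightarrow> m \<in> L \<Longrightarrow> parallel l m \<Longrightarrow> translation_along l f \<Longrightarrow> translation_along m f"
  unfolding translation_along_def using par_cong by metis

text \<open>If \<open>X\<close> moves, its join with the image gives the direction of both maps; if
  \<open>X\<close> is fixed, both are the identity on the points.\<close>

lemma is_translation_unique:
  assumes f: "is_translation f" and g: "is_translation g" and X: "X \<in> Pts" "f X = g X" and Y: "Y \<in> Pts"
  shows "f Y = g Y"
proof -
  obtain l m where l: "l \<in> L" "translation_along l f" and m: "m \<in> L" "translation_along m g"
    using f g unfolding is_translation_def by auto
  show ?thesis
  proof (cases "f X = X")
    case True
    then show ?thesis using translation_along_fixed l m X Y by metis
  next
    case False
    have "f X \<in> par l X" "f X \<in> par m X" using l m X unfolding translation_along_def by auto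
    then have "par l X = par m X" using line_unique par l m X False by metis
    then have "parallel l m" using par[of l X] par[of m X] l m X parallel_trans parallel_sym by metis
    then have "translation_along l g" using translation_along_cong l m parallel_sym by blast
    then show ?thesis using translation_along_unique_same l X Y by blast
  qed
qed

text \<open>In a dilatation without fixed points all traces are parallel: traces are invariant, so a
  common point of two of them would be fixed.\<close>

lemma fixed_point_free_is_translation:
  assumes f: "dil f" and nofix: "\<And>X. X \<in> Pts \<Longrightarrow> f X \<noteq> X"
  shows "is_translation f"
proof -
  obtain P where P: "P \<in> Pts" using points_nonempty by auto
  have j: "join X (f X) \<in> L" "X \<in> join X (f X)" "f X \<in> join X (f X)" if "X \<in> Pts" for X
    using line_through[OF that dil_point[OF f that]] nofix[OF that] by auto
  have "f X \<in> par (join P (f P)) X" if X: "X \<in> Pts" for X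
  proof -
    have "parallel (join X (f X)) (join P (f P))"
    proof (rule ccontr)
      assume n: "\<not> parallel (join X (f X)) (join P (f P))"
      then obtain W where W: "W \<in> join X (f X)" "W \<in> join P (f P)" using meet_ex j P X by blast
      then have "f W \<in> join X (f X)" "f W \<in> join P (f P)"
        using dil_join f P X nofix by blast+
      then have "f W = W" using meet_unique[OF _ _ n] j P X W by blast
      then show False using nofix W line_point j X by blast
    qed
    then show ?thesis using par_eqI j X P by metis
  qed
  then show ?thesis unfolding is_translation_def translation_along_def using f j P by blast
qed

text \<open>Only a composition with a fixed point \<open>X\<close> needs work. With parallel
  directions it runs along the common one. Otherwise g X lies on both parallels through
  \<open>X\<close>, so \<open>g\<close> fixes \<open>X\<close>, acts as the identity, and
  \<open>f\<close> remains.\<close>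

lemma is_translation_comp:
  assumes f: "is_translation f" and g: "is_translation g"
  shows "is_translation (f \<circ> g)"
proof (cases "\<exists>X\<in>Pts. f (g X) = X")
  case False
  then show ?thesis using fixed_point_free_is_translation dil_comp f g is_translation_dil by auto
next
  case True
  then obtain X where X: "X \<in> Pts" "f (g X) = X" by auto
  obtain l m where l: "l \<in> L" "translation_along l f" and m: "m \<in> L" "translation_along m g"
    using f g unfolding is_translation_def by auto
  have gp: "g Y \<in> Pts" if "Y \<in> Pts" for Y using that g is_translation_dil dil_point by blast
  show ?thesis
  proof (cases "parallel l m")
    case True
    then have "translation_along l g" using translation_along_cong l m parallel_sym by blast
    then have "f (g Y) \<in> par l Y" if "Y \<in> Pts" for Y
      using that l gp par_mem_eq unfolding translation_along_def by metis
    then show ?thesis unfolding is_translation_def translation_along_def using l dil_comp f g is_translation_dil by auto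
  next
    case False
    have 1: "g X \<in> par m X" using m X unfolding translation_along_def by auto
    have "X \<in> par l (g X)" using l X gp unfolding translation_along_def by metis
    then have 2: "g X \<in> par l X" using par_mem_sym l X gp by blast
    have "g X = X"
    proof (rule ccontr)
      assume "g X \<noteq> X"
      then have "par l X = par m X" using line_unique par l m X 1 2 by metis
      then have "parallel l m" using par[of l X] par[of m X] l m X parallel_trans parallel_sym by metis
      then show False using False by simp
    qed
    then have "g Y = Y" if "Y \<in> Pts" for Y using translation_along_fixed m X that by blast
    then have "f (g Y) \<in> par l Y" if "Y \<in> Pts" for Y
      using that l unfolding translation_along_def by metis
    then show ?thesis unfolding is_translation_def translation_along_def using l dil_comp f g is_translation_dil by auto
  qed
qed

text \<open>Conjugating \<open>f\<close> by \<open>d\<close> gives a translation of the same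
  direction, which equals \<open>g\<close> on all points as soon as it does so on one. This will
  make homotheties additive.\<close>

lemma is_translation_conj:
  assumes d: "dil d" and f: "is_translation f" and g: "is_translation g"
    and X0: "X0 \<in> Pts" "g (d X0) = d (f X0)" and X: "X \<in> Pts"
  shows "g (d X) = d (f X)"
proof -
  let ?h = "d \<circ> f \<circ> inv_into Pts d"
  obtain l where l: "l \<in> L" "translation_along l f" using f unfolding is_translation_def by auto
  note di = dil_inv[OF d]
  have "dil ?h" using dil_comp di(1) d f is_translation_dil by blast
  moreover have "?h Y \<in> par l Y" if Y: "Y \<in> Pts" for Y
  proof -
    have "f (inv_into Pts d Y) \<in> par l (inv_into Pts d Y)"
      using l di(4) Y unfolding translation_along_def by blast
    then show ?thesis using dil_par[OF d l(1) di(4)[OF Y]] di(3) Y by fastforce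
  qed
  ultimately have h: "is_translation ?h" unfolding is_translation_def translation_along_def using l by blast
  have "?h (d X0) = g (d X0)" using X0 di(2) by simp
  then have "?h (d X) = g (d X)" using is_translation_unique[OF h g] dil_point d X0 X by metis
  then show ?thesis using di(2) X by simp
qed

text \<open>Both sides are the meeting point of the parallel to \<open>l\<close> through g X and the
  parallel to \<open>m\<close> through f X.\<close>

lemma translation_along_commute_nonparallel:
  assumes l: "l \<in> L" "translation_along l f" and m: "m \<in> L" "translation_along m g" and n: "\<not> parallel l m"
    and X: "X \<in> Pts"
  shows "f (g X) = g (f X)"
proof -
  have fp: "f Y \<in> Pts" "g Y \<in> Pts" if "Y \<in> Pts" for Y
    using that l m dil_point translation_along_dil by blast+
  have 1: "f (g X) \<in> par l (g X)" "g (f X) \<in> par m (f X)"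
    using l m X fp unfolding translation_along_def by auto
  have 2: "f (g X) \<in> par m (f X)" "g (f X) \<in> par l (g X)"
    using dil_par l m X translation_along_dil unfolding translation_along_def by metis+
  have "\<not> parallel (par l (g X)) (par m (f X))"
    using par[OF l(1)] par[OF m(1)] fp X n parallel_trans parallel_sym l m by metis
  then show ?thesis using meet_unique 1 2 par l m fp X by metis
qed

end

text \<open>\<open>third_parallel\<close> says that every parallel class has at least three lines,
  which is the requirement \<open>third\<close> for pencils of parallels.\<close>

locale thick_desargues_plane = finite_desargues_affine_plane Pts L for Pts :: "'a set" and L +
  assumes third_parallel: "l \<in> L \<Longrightarrow> A \<in> Pts \<Longrightarrow> B \<in> Pts \<Longrightarrow> \<exists>C\<in>Pts. C \<notin> par l A \<and> C \<notin> par l B"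
begin

text \<open>Surjectivity comes from finiteness, so a map built from a pencil need only be
  injective.\<close>

lemma dilI:
  assumes "\<And>X. X \<in> Pts \<Longrightarrow> f X \<in> Pts" "inj_on f Pts" "\<And>l X Y. l \<in> L \<Longrightarrow> X \<in> l \<Longrightarrow> Y \<in> l \<Longrightarrow> f Y \<in> par l (f X)"
  shows "dil f"
  unfolding dil_def bij_betw_def using assms endo_inj_surj[OF finite_points] by blast

lemma pencil_parallel:
  assumes l: "l \<in> L"
  shows "pencil Pts L {} (par l)"
proof
  fix A B C assume A: "A \<in> Pts - {}" and B: "B \<in> Pts - {}" and C: "C \<in> Pts - {}"
  have "parallel (par l X) (par l Y)" if "X \<in> Pts" "Y \<in> Pts" for X Y
    using par l that parallel_trans parallel_sym by metis
  then show "parallel (par l A) (par l B) \<and> parallel (par l B) (par l C) \<or>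
      (\<exists>Z. par l A \<inter> par l B \<inter> par l C = {Z} \<and> {} = {Z})" using A B C by auto
next
  fix A B assume "A \<in> Pts - {}" "B \<in> Pts - {}"
  then obtain C where C: "C \<in> Pts" "C \<notin> par l A" "C \<notin> par l B" using third_parallel l by blast
  then have "C \<in> par l C" using par l by blast
  then show "\<exists>C\<in>Pts - {}. par l C \<noteq> par l A \<and> par l C \<noteq> par l B" using C by auto
next
  show "par l Y = par l X" if "X \<in> Pts - {}" "Y \<in> par l X - {}" for X Y
    using that par_mem_eq l by simp
qed (use par[OF l] in auto)

lemma pencil_central:
  assumes E: "E \<in> Pts"
  shows "pencil Pts L {E} (join E)"
proof
  have j: "join E X \<in> L" "E \<in> join E X" "X \<in> join E X" if "X \<in> Pts - {E}" for X
    using line_through E that by auto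
  show je: "join E Y = join E X" if "X \<in> Pts - {E}" "Y \<in> join E X - {E}" for X Y
    using that j[OF that(1)] line_through_eq[of "join E X" E Y] by auto
  show "\<And>X. X \<in> Pts - {E} \<Longrightarrow> join E X \<in> L" "\<And>X. X \<in> Pts - {E} \<Longrightarrow> X \<in> join E X"
    "\<And>X. X \<in> Pts - {E} \<Longrightarrow> {E} \<subseteq> join E X" using j by auto
  have meet: "join E A \<inter> join E B = {E}" if "A \<in> Pts - {E}" "B \<in> Pts - {E}" "join E A \<noteq> join E B" for A B
    using j[OF that(1)] j[OF that(2)] line_unique[of "join E A" "join E B" E] that(3) by auto
  show "parallel (join E A) (join E B) \<and> parallel (join E B) (join E C) \<or>
      (\<exists>Z. join E A \<inter> join E B \<inter> join E C = {Z} \<and> {E} = {Z})"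
    if "A \<in> Pts - {E}" "B \<in> Pts - {E}" "C \<in> Pts - {E}" "join E A \<noteq> join E B" for A B C
    using meet[of A B] j[of C] that by auto
  show "\<exists>C\<in>Pts - {E}. join E C \<noteq> join E A \<and> join E C \<noteq> join E B"
    if A: "A \<in> Pts - {E}" and B: "B \<in> Pts - {E}" for A B
  proof (cases "join E A = join E B")
    case True
    obtain C where C: "C \<in> Pts" "C \<notin> join E A" using off_line j A by blast
    then have "C \<in> Pts - {E}" using j A by auto
    then show ?thesis using C True j by metis
  next
    case False
    have "A \<noteq> B" using False by auto
    then have AB: "join A B \<in> L" "A \<in> join A B" "B \<in> join A B" using line_through A B by auto
    \<comment> \<open>Besides the lines from \<open>E\<close> to \<open>A\<close> and to
      \<open>B\<close>, the parallel to \<open>join A B\<close> is a third line through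
      \<open>E\<close>.\<close>
    let ?p = "par (join A B) E"
    have p: "?p \<in> L" "E \<in> ?p" "parallel ?p (join A B)" using par AB E by auto
    obtain C where C: "C \<in> ?p" "C \<noteq> E" using other_point p E by blast
    then have C': "C \<in> Pts - {E}" using line_point p by blast
    have "join E C = ?p" using line_through_eq p C by blast
    moreover have "E \<notin> join A B"
    proof
      assume "E \<in> join A B"
      then have "join E A = join A B" "join E B = join A B" 
        using line_through_eq[of "join A B" E] AB A B by auto
      then show False using False by simp
    qed
    then have "A \<notin> ?p" "B \<notin> ?p" using p AB parallel_eq by metis+
    ultimately show ?thesis using C' j A B by metis
  qed
qed (use E in auto)

lemma exists_translation_along:
  assumes l: "l \<in> L" and X: "X \<in> Pts" and Y: "Y \<in> par l X"
  obtains f where "translation_along l f" "f X = Y"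
proof -
  interpret pencil Pts L "{}" "par l" using pencil_parallel l by blast
  obtain f where f: "f X = Y" "\<And>Z. Z \<in> Pts - {} \<Longrightarrow> f Z \<in> par l Z - {}"
    "inj_on f Pts" "\<And>l X Y. l \<in> L \<Longrightarrow> X \<in> l \<Longrightarrow> Y \<in> l \<Longrightarrow> f Y \<in> par l (f X)"
    using exists_pencil_dilatation[of X Y] X Y by auto
  have "dil f"
  proof (rule dilI)
    show "f Z \<in> Pts" if "Z \<in> Pts" for Z using f(2) that line_point par l by blast
  qed (use f in auto)
  then show thesis using that f unfolding translation_along_def by auto
qed

lemma exists_is_translation:
  assumes X: "X \<in> Pts" and Y: "Y \<in> Pts"
  obtains f where "is_translation f" "f X = Y"
proof (cases "X = Y")
  case True
  then show thesis using that is_translation_id by blast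
next
  case False
  then have j: "join X Y \<in> L" "X \<in> join X Y" "Y \<in> join X Y" using line_through X Y by auto
  then have "Y \<in> par (join X Y) X" using par_self by auto
  then show thesis using exists_translation_along j X that unfolding is_translation_def by metis
qed

lemma exists_homothety:
  assumes E: "E \<in> Pts" and X: "X \<in> Pts" "X \<noteq> E" and Y: "Y \<in> join E X" "Y \<noteq> E"
  obtains f where "dil f" "f E = E" "f X = Y"
proof -
  interpret pencil Pts L "{E}" "join E" using pencil_central E by blast
  obtain f where f: "f X = Y" "f E = E" "\<And>Z. Z \<in> Pts - {E} \<Longrightarrow> f Z \<in> join E Z - {E}"
    "inj_on f Pts" "\<And>l X Y. l \<in> L \<Longrightarrow> X \<in> l \<Longrightarrow> Y \<in> l \<Longrightarrow> f Y \<in> par l (f X)"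
    using exists_pencil_dilatation[of X Y] X Y by auto
  have "dil f"
  proof (rule dilI)
    show "f Z \<in> Pts" if "Z \<in> Pts" for Z
      using f(2) f(3)[of Z] that line_point[of "join E Z" "f Z"] lam(1)[of Z] E by (cases "Z = E") auto
  qed (use f in auto)
  then show thesis using that f by auto
qed

text \<open>For parallel directions, pick a translation \<open>h\<close> of another direction. Then
  \<open>g \<circ> h\<close> also has a direction different from that of \<open>f\<close>, so f g h
  = g h f = g f h on the points, and \<open>h\<close> is onto.\<close>

lemma is_translation_commute:
  assumes f: "is_translation f" and g: "is_translation g" and X: "X \<in> Pts"
  shows "f (g X) = g (f X)"
proof -
  obtain l m where l: "l \<in> L" "translation_along l f" and m: "m \<in> L" "translation_along m g"
    using f g unfolding is_translation_def by auto
  show ?thesis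
  proof (cases "parallel l m")
    case False
    then show ?thesis using translation_along_commute_nonparallel l m X by blast
  next
    case True
    then have g': "translation_along l g" using translation_along_cong l m parallel_sym by blast
    obtain Z where Z: "Z \<in> Pts" "Z \<notin> par l X" using off_line par l X by blast
    obtain h where h: "is_translation h" "h X = Z" using exists_is_translation X Z by blast
    obtain k where k: "k \<in> L" "translation_along k h" using h unfolding is_translation_def by auto
    have hp: "h Y \<in> Pts" if "Y \<in> Pts" for Y using that h is_translation_dil dil_point by blast
    have gp: "g Y \<in> Pts" if "Y \<in> Pts" for Y using that g is_translation_dil dil_point by blast
    have "\<not> parallel l k"
    proof
      assume "parallel l k"
      then have "par l X = par k X" using par_cong l k X by blast
      moreover have "h X \<in> par k X" using k X unfolding translation_along_def by blast
      ultimately show False using Z h by simp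
    qed
    then have fh: "f (h Y) = h (f Y)" if "Y \<in> Pts" for Y
      using translation_along_commute_nonparallel[OF l k] that by blast
    have gh: "is_translation (g \<circ> h)" using is_translation_comp g h by blast
    then obtain n where n: "n \<in> L" "translation_along n (g \<circ> h)" unfolding is_translation_def by auto
    have "\<not> parallel l n"
    proof
      assume "parallel l n"
      then have "(g \<circ> h) X \<in> par l X" using n X par_cong l unfolding translation_along_def by metis
      then have "g Z \<in> par l X" using h by simp
      moreover have "g Z \<in> par l Z" using g' Z unfolding translation_along_def by blast
      ultimately have "par l X = par l Z" using par_mem_eq l X Z by metis
      then show False using par l Z by auto
    qed
    then have c: "f (g (h Y)) = g (h (f Y))" if "Y \<in> Pts" for Y
      using translation_along_commute_nonparallel[OF l n] that by simp
    obtain Y where Y: "Y \<in> Pts" "h Y = X" using dil_surj is_translation_dil h X by metis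
    then show ?thesis using c fh by metis
  qed
qed

end

section \<open>Pappus' theorem\<close>

locale pointed_desargues_plane = thick_desargues_plane Pts L for Pts :: "'a set" and L +
  fixes E :: 'a
  assumes origin: "E \<in> Pts"
begin

text \<open>For a point \<open>P\<close> the choice affects only values outside \<open>Pts\<close>,
  by \<open>is_translation_unique\<close>.\<close>

definition translate :: "'a \<Rightarrow> 'a \<Rightarrow> 'a" where
  "translate P = (SOME f. is_translation f \<and> f E = P)"

lemma translate:
  assumes "P \<in> Pts"
  shows "is_translation (translate P)" "translate P E = P"
proof -
  have "\<exists>f. is_translation f \<and> f E = P" using exists_is_translation[OF origin assms] by blast
  then have "is_translation (translate P) \<and> translate P E = P" unfolding translate_def by (rule someI_ex)
  then show "is_translation (translate P)" "translate P E = P" by auto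
qed

lemma translate_dil: "P \<in> Pts \<Longrightarrow> dil (translate P)"
  using translate is_translation_dil by blast

lemma translate_point: "P \<in> Pts \<Longrightarrow> Q \<in> Pts \<Longrightarrow> translate P Q \<in> Pts"
  using translate_dil dil_point by blast

lemma translate_eq: "P \<in> Pts \<Longrightarrow> is_translation f \<Longrightarrow> f E = P \<Longrightarrow> Q \<in> Pts \<Longrightarrow> translate P Q = f Q"
  using is_translation_unique[of "translate P" f E Q] translate origin by simp

definition vectors :: "'a monoid" where
  "vectors = \<lparr>carrier = Pts, mult = translate, one = E\<rparr>"

lemma vectors_simps:
  "carrier vectors = Pts" "P \<otimes>\<^bsub>vectors\<^esub> Q = translate P Q" "\<one>\<^bsub>vectors\<^esub> = E"
  unfolding vectors_def by simp_all

lemma vectors_comm_group: "comm_group vectors"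
proof (rule comm_groupI; unfold vectors_simps)
  fix P Q R assume P: "P \<in> Pts" and Q: "Q \<in> Pts" and R: "R \<in> Pts"
  show "translate P Q \<in> Pts" using translate_point P Q .
  show "translate (translate P Q) R = translate P (translate Q R)"
    using translate_eq[OF translate_point[OF P Q] is_translation_comp[OF translate(1)[OF P] translate(1)[OF Q]] _ R] translate(2)[OF Q] by simp
  have "translate P (translate Q E) = translate Q (translate P E)" using is_translation_commute translate P Q origin by blast
  then show "translate P Q = translate Q P" using translate P Q by simp
  show "translate E P = P" using translate_eq[OF origin is_translation_id refl P] .
  obtain Q where Q: "Q \<in> Pts" "translate P Q = E" using dil_surj[OF translate_dil[OF P] origin] by blast
  have "translate Q (translate P E) = translate P (translate Q E)" using is_translation_commute translate P Q origin by blast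
  then have "translate Q P = E" using translate P Q by simp
  then show "\<exists>Q\<in>Pts. translate Q P = E" using Q by blast
qed (rule origin)

lemma translate_line:
  assumes l: "l \<in> L" "E \<in> l" and P: "P \<in> Pts" and Q: "Q \<in> Pts"
  shows "translate P Q \<in> par l P \<longleftrightarrow> Q \<in> l"
  using dil_par_iff[OF translate_dil[OF P] l(1) origin Q] translate(2)[OF P] par_self[OF l] by simp

definition lines_at_origin :: "'a set set" where
  "lines_at_origin = {l \<in> L. E \<in> l}"

sublocale group_partition vectors lines_at_origin
proof -
  interpret comm_group vectors by (rule vectors_comm_group)
  show "group_partition vectors lines_at_origin"
  proof (intro group_partition.intro group_partition_axioms.intro vectors_comm_group)
    show "finite (carrier vectors)" using finite_points vectors_simps by simp
  next
    fix l assume "l \<in> lines_at_origin"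
    then have l: "l \<in> L" "E \<in> l" unfolding lines_at_origin_def by auto
    have lP: "l \<subseteq> Pts" using lines_subset l by blast
    show "subgroup l vectors"
    proof
      show "l \<subseteq> carrier vectors" using lP vectors_simps by simp
      show "\<one>\<^bsub>vectors\<^esub> \<in> l" using l vectors_simps by simp
      show "X \<otimes>\<^bsub>vectors\<^esub> Y \<in> l" if "X \<in> l" "Y \<in> l" for X Y
        using that translate_line[OF l, of X Y] lP par_self[OF l(1) that(1)] vectors_simps by auto
      fix X assume X: "X \<in> l"
      then have XP: "X \<in> Pts" using lP by blast
      have i: "inv\<^bsub>vectors\<^esub> X \<in> Pts" "translate X (inv\<^bsub>vectors\<^esub> X) = E"
        using inv_closed[of X] r_inv[of X] XP unfolding vectors_simps by auto
      then show "inv\<^bsub>vectors\<^esub> X \<in> l" using translate_line[OF l XP i(1)] par_self[OF l(1) X] l by simp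
    qed
  next
    fix l assume "l \<in> lines_at_origin"
    then have l: "l \<in> L" "E \<in> l" unfolding lines_at_origin_def by auto
    show "l \<noteq> carrier vectors" using off_line[OF l(1)] vectors_simps by metis
  next
    fix l m assume "l \<in> lines_at_origin" "m \<in> lines_at_origin" "l \<noteq> m"
    then have l: "l \<in> L" "E \<in> l" and "m \<in> L" "E \<in> m" "l \<noteq> m" unfolding lines_at_origin_def by auto
    then show "l \<inter> m = {\<one>\<^bsub>vectors\<^esub>}" using l line_unique vectors_simps by auto
  next
    fix X assume "X \<in> carrier vectors"
    then have X: "X \<in> Pts" by (simp add: vectors_simps)
    show "\<exists>l\<in>lines_at_origin. X \<in> l"
    proof (cases "X = E")
      case True
      obtain Y where "Y \<in> Pts" "Y \<noteq> E" using three_points by metis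
      then have "join E Y \<in> L" "E \<in> join E Y" using line_through origin by metis+
      then show ?thesis using True unfolding lines_at_origin_def by blast
    next
      case False
      then have "join E X \<in> L" "E \<in> join E X" "X \<in> join E X" using line_through origin X by auto
      then show ?thesis unfolding lines_at_origin_def by blast
    qed
  qed
qed

text \<open>\<open>Y\<close> is the sum of \<open>X\<close> and a vector \<open>W\<close> on the
  parallel to \<open>l\<close> through the origin. A scalar is additive and keeps \<open>W\<close>
  on that parallel.\<close>

lemma scalar_par:
  assumes f: "f \<in> carrier scalars" and l: "l \<in> L" and X: "X \<in> Pts" and Y: "Y \<in> par l X"
  shows "f Y \<in> par l (f X)"
proof -
  let ?m = "par l E"
  have m: "?m \<in> L" "E \<in> ?m" using par[OF l origin] by auto
  have YP: "Y \<in> Pts" using Y par[OF l X] line_point by blast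
  obtain W where W: "W \<in> Pts" "translate X W = Y" using dil_surj[OF translate_dil[OF X] YP] by blast
  have "W \<in> ?m" using translate_line[OF m X W(1)] W(2) Y par_par[OF l origin X] by simp
  then have fW: "f W \<in> ?m" using scalarsD(4)[OF f] m unfolding lines_at_origin_def by blast
  have p: "f X \<in> Pts" "f W \<in> Pts" using scalarsD(2)[OF f] X W vectors_simps by auto
  have "f Y = translate (f X) (f W)" using scalarsD(3)[OF f] X W vectors_simps by metis
  then show ?thesis using translate_line[OF m p] fW par_par[OF l origin p(1)] by simp
qed

text \<open>A homothety \<open>d\<close> centred at \<open>E\<close> is additive: it conjugates the
  translation by \<open>P\<close> into the translation by d P, as a comparison at \<open>E\<close>
  shows.\<close>

lemma scalar_ex:
  assumes X: "X \<in> Pts" "X \<noteq> E" and Y: "Y \<in> join E X" "Y \<noteq> E"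
  obtains f where "f \<in> carrier scalars" "f X = Y"
proof -
  obtain d where d: "dil d" "d E = E" "d X = Y" using exists_homothety[OF origin X Y] .
  have "restrict d (carrier vectors) \<in> carrier scalars"
  proof (rule scalarsI; unfold vectors_simps)
    show dp: "d P \<in> Pts" if "P \<in> Pts" for P using d dil_point that by blast
    show "d (translate P Q) = translate (d P) (d Q)" if P: "P \<in> Pts" and Q: "Q \<in> Pts" for P Q
    proof -
      have "translate (d P) (d E) = d (translate P E)" using translate(2) dp P d(2) by simp
      then show ?thesis using is_translation_conj[OF d(1) translate(1)[OF P] translate(1)[OF dp[OF P]] origin _ Q] by simp
    qed
    show "d P \<in> l" if "l \<in> lines_at_origin" "P \<in> l" for l P
    proof -
      have l: "l \<in> L" "E \<in> l" using that unfolding lines_at_origin_def by auto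
      then have "d P \<in> par l (d E)" using d(1) that unfolding dil_def by blast
      then show ?thesis using d(2) par_self l by simp
    qed
  qed
  then show thesis using that d(3) X vectors_simps by (metis restrict_apply')
qed

text \<open>Let \<alpha>, \<beta>, \<gamma> be the scalars taking P1 to P5, P3 to P5 and P1 to P3.
  Then \<alpha> = \<beta>\<gamma>, as seen at P1, and the parallel sides say that \<alpha> takes P2
  to P4 and \<beta> takes P2 to P6. Commuting \<beta> and \<gamma> at P2 gives \<gamma> P6 = P4, so
  \<gamma> takes the line P1 P6 to the parallel line P3 P4.\<close>

lemma pappus_central:
  assumes l: "l \<in> L" "E \<in> l" and m: "m \<in> L" "E \<in> m" and lm: "l \<noteq> m"
    and P: "P1 \<in> l - {E}" "P3 \<in> l - {E}" "P5 \<in> l - {E}"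
    and Q: "P2 \<in> m - {E}" "P4 \<in> m - {E}" "P6 \<in> m - {E}"
    and 1: "P4 \<in> par (join P1 P2) P5" and 2: "P6 \<in> par (join P2 P3) P5"
  shows "P4 \<in> par (join P1 P6) P3"
proof -
  have pts: "P1 \<in> Pts" "P2 \<in> Pts" "P3 \<in> Pts" "P4 \<in> Pts" "P5 \<in> Pts" "P6 \<in> Pts"
    using P Q l m line_point by auto
  have meet: "X = E" if "X \<in> l" "X \<in> m" for X using that l m lm line_unique by blast
  have ne: "X \<noteq> Y" if "X \<in> l - {E}" "Y \<in> m - {E}" for X Y using meet that by auto
  have j: "join X Y \<in> L" "X \<in> join X Y" "Y \<in> join X Y" if "X \<in> l - {E}" "Y \<in> m - {E}" for X Y
    using line_through[of X Y] ne[OF that] that l m line_point by auto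
  have jl: "join E X = l" if "X \<in> l - {E}" for X using line_through_eq[of l E X] l that by auto
  have ex: "\<exists>f\<in>carrier scalars. f X = Y" if "X \<in> l - {E}" "Y \<in> l - {E}" for X Y
    using scalar_ex[of X Y] jl[OF that(1)] that l line_point by blast
  \<comment> \<open>A value on one carrier determines the values on the other: f Y is where
    \<open>m\<close> meets the parallel to \<open>join X Y\<close> through
    \<open>X'\<close>.\<close>
  have move: "f Y = Y'"
    if f: "f \<in> carrier scalars" "f X = X'" and X: "X \<in> l - {E}" "X' \<in> l - {E}"
      and Y: "Y \<in> m - {E}" "Y' \<in> m - {E}" "Y' \<in> par (join X Y) X'" for f X X' Y Y'
  proof (rule ccontr)
    assume n: "f Y \<noteq> Y'"
    have XP: "X \<in> Pts" "X' \<in> Pts" using X l line_point by auto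
    have "Y \<in> par (join X Y) X" using j[OF X(1) Y(1)] par_self by simp
    then have "f Y \<in> par (join X Y) X'" using scalar_par[OF f(1) j(1)[OF X(1) Y(1)] XP(1)] f(2) by simp
    moreover have "f Y \<in> m" using scalarsD(4)[OF f(1)] m Y unfolding lines_at_origin_def by blast
    ultimately have "par (join X Y) X' = m"
      using line_unique[OF _ m(1), of _ "f Y" Y'] par(1)[OF j(1)[OF X(1) Y(1)] XP(2)] Y n by blast
    then have "X' \<in> m" using par(2)[OF j(1)[OF X(1) Y(1)] XP(2)] by simp
    then show False using meet X by auto
  qed
  obtain \<alpha> where a: "\<alpha> \<in> carrier scalars" "\<alpha> P1 = P5" using ex P by blast
  obtain \<beta> where b: "\<beta> \<in> carrier scalars" "\<beta> P3 = P5" using ex P by blast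
  obtain \<gamma> where c: "\<gamma> \<in> carrier scalars" "\<gamma> P1 = P3" using ex P by blast
  have a2: "\<alpha> P2 = P4" using move[OF a P(1,3) Q(1,2) 1] .
  have b2: "\<beta> P2 = P6" using move[OF b P(2,3) Q(1,3)] 2 join_commute by metis
  have "\<alpha> = \<beta> \<otimes>\<^bsub>scalars\<^esub> \<gamma>"
    using scalar_unique[OF a(1) scalars_mult_closed[OF b(1) c(1)], of P1] P(1) pts(1) a(2) b(2) c(2)
    by (simp add: vectors_simps scalars_simps)
  then have "P4 = \<beta> (\<gamma> P2)" using a2 pts by (simp add: scalars_simps vectors_simps)
  also have "\<dots> = \<gamma> P6" using scalars_commute[OF b(1) c(1), of P2] pts b2 by (simp add: vectors_simps)
  finally have "\<gamma> P6 = P4" by simp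
  moreover have "P6 \<in> par (join P1 P6) P1" using j[OF P(1) Q(3)] par_self by simp
  ultimately show ?thesis
    using scalar_par[OF c(1) j(1)[OF P(1) Q(3)] pts(1)] c(2) by metis
qed

end

section \<open>Parallel carriers, and Pappus' theorem in thick planes\<close>

context thick_desargues_plane
begin

text \<open>With translations \<open>f\<close> from P1 to P2 and \<open>g\<close> from P2 to P3, the
  parallel sides give f P5 = P4 and g P6 = P5. As \<open>f\<close> and \<open>g\<close> commute,
  \<open>f \<circ> g\<close> takes P1 to P3 and P6 to P4, so the lines P1 P6 and P3 P4 are
  parallel.\<close>

lemma pappus_parallel:
  assumes l: "l \<in> L" and m: "m \<in> L" and lm: "l \<inter> m = {}"
    and P: "P1 \<in> l" "P3 \<in> l" "P5 \<in> l" and Q: "P2 \<in> m" "P4 \<in> m" "P6 \<in> m"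
    and 1: "P4 \<in> par (join P1 P2) P5" and 2: "P6 \<in> par (join P2 P3) P5"
  shows "P4 \<in> par (join P1 P6) P3"
proof -
  have pts: "P1 \<in> Pts" "P2 \<in> Pts" "P3 \<in> Pts" "P4 \<in> Pts" "P5 \<in> Pts" "P6 \<in> Pts"
    using P Q l m line_point by auto
  have j: "join X Y \<in> L" "X \<in> join X Y" "Y \<in> join X Y" if "X \<in> l" "Y \<in> m" for X Y
    using line_through[of X Y] that l m line_point lm by auto
  have pm: "par k X = k'" if "k \<in> {l, m}" "k' \<in> {l, m}" "X \<in> k'" for k k' X
    using that par_eqI[of k k' X] l m lm unfolding parallel_def by auto
  \<comment> \<open>A translation that takes one point of \<open>k\<close> to \<open>k'\<close>
    takes all of \<open>k\<close> there, so f Y is where \<open>k'\<close> meets the trace of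
    \<open>Y\<close>.\<close>
  have move: "f Y = Y'"
    if f: "translation_along n f" "n \<in> L" and k: "k \<in> {l, m}" "k' \<in> {l, m}" "k \<noteq> k'"
      and X: "X \<in> k" "f X \<in> k'" and Y: "Y \<in> k" "Y' \<in> k'" "Y' \<in> par n Y" for f n k k' X Y Y'
  proof (rule ccontr)
    assume ne: "f Y \<noteq> Y'"
    have kL: "k \<in> L" "k' \<in> L" "k \<inter> k' = {}" using k l m lm by auto
    have YP: "Y \<in> Pts" using Y kL line_point by blast
    have "f Y \<in> par n Y" using f YP unfolding translation_along_def by blast
    moreover have "f Y \<in> par k (f X)" using f X Y kL unfolding translation_along_def dil_def by blast
    then have "f Y \<in> k'" using pm k X by simp
    ultimately have "par n Y = k'" using line_unique[OF par(1)[OF f(2) YP] kL(2)] Y ne by blast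
    then have "Y \<in> k'" using par(2)[OF f(2) YP] by simp
    then show False using Y kL by blast
  qed
  have n: "l \<noteq> m" using lm P by auto
  have "P2 \<in> par (join P1 P2) P1" using j[OF P(1) Q(1)] par_self by simp
  then obtain f where f: "translation_along (join P1 P2) f" "f P1 = P2"
    using exists_translation_along[OF j(1)[OF P(1) Q(1)] pts(1)] by blast
  have j23: "join P2 P3 \<in> L" "P2 \<in> join P2 P3" "P3 \<in> join P2 P3" using j[OF P(2) Q(1)] join_commute by metis+
  have "P3 \<in> par (join P2 P3) P2" using j23 par_self by simp
  then obtain g where g: "translation_along (join P2 P3) g" "g P2 = P3"
    using exists_translation_along[OF j23(1) pts(2)] by blast
  have f5: "f P5 = P4" using move[OF f(1) j(1)[OF P(1) Q(1)], of l m P1 P5 P4] n P Q f(2) 1 by simp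
  have "P5 \<in> par (join P2 P3) P6" using par_mem_sym[OF j23(1) pts(5) 2] .
  then have g6: "g P6 = P5" using move[OF g(1) j23(1), of m l P2 P6 P5] n P Q g(2) by simp
  have t: "is_translation f" "is_translation g" unfolding is_translation_def using f g j(1)[OF P(1) Q(1)] j23 by auto
  have "f (g P1) = P3" using is_translation_commute[OF t pts(1)] f(2) g(2) by simp
  moreover have "f (g P6) = P4" using f5 g6 by simp
  moreover have "dil (f \<circ> g)" using dil_comp t is_translation_dil by blast
  then have "(f \<circ> g) P6 \<in> par (join P1 P6) ((f \<circ> g) P1)"
    using j[OF P(1) Q(3)] unfolding dil_def by blast
  ultimately show ?thesis by simp
qed

lemma pappian_thick: "pappian Pts L"
  unfolding pappian_def
proof (intro ballI impI)
  fix P1 P2 P3 P4 P5 P6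
  assume pts: "P1 \<in> Pts" "P2 \<in> Pts" "P3 \<in> Pts" "P4 \<in> Pts" "P5 \<in> Pts" "P6 \<in> Pts"
    and ne: "P1 \<noteq> P3" "P2 \<noteq> P4" "P1 \<noteq> P2" "P2 \<noteq> P3" "P3 \<noteq> P4" "P4 \<noteq> P5" "P5 \<noteq> P6" "P6 \<noteq> P1"
    and card: "card (join P1 P3 \<inter> join P2 P3) = 1"
    and P5: "P5 \<in> join P1 P3" and P6: "P6 \<in> join P2 P4"
    and par1: "parallel (join P1 P2) (join P4 P5)" and par2: "parallel (join P2 P3) (join P5 P6)"
  define l m where "l = join P1 P3" and "m = join P2 P4"
  have l: "l \<in> L" "P1 \<in> l" "P3 \<in> l" "P5 \<in> l" unfolding l_def using line_through pts ne P5 by auto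
  have m: "m \<in> L" "P2 \<in> m" "P4 \<in> m" "P6 \<in> m" unfolding m_def using line_through pts ne P6 by auto
  have P2: "P2 \<notin> l"
  proof
    assume "P2 \<in> l"
    then have "join P2 P3 = l" using l ne line_through_eq by blast
    then have "card l = 1" using card unfolding l_def by simp
    then show False using l ne by (metis card_1_singletonE singletonD)
  qed
  have j: "join X Y \<in> L" "X \<in> join X Y" "Y \<in> join X Y" if "X \<in> Pts" "Y \<in> Pts" "X \<noteq> Y" for X Y
    using line_through that by auto
  have jl: "join X Y = l" if "X \<in> l" "Y \<in> l" "X \<noteq> Y" for X Y using line_through_eq l(1) that by blast
  have jm: "join X Y = m" if "X \<in> m" "Y \<in> m" "X \<noteq> Y" for X Y using line_through_eq m(1) that by blast
  note j12 = j[OF pts(1,2) ne(3)] and j45 = j[OF pts(4,5) ne(6)]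
    and j23 = j[OF pts(2,3) ne(4)] and j56 = j[OF pts(5,6) ne(7)]
  have "par (join P1 P2) P5 = join P4 P5" using par_eqI j12 j45 par1 parallel_sym by blast
  then have 1: "P4 \<in> par (join P1 P2) P5" using j45 by simp
  have "par (join P2 P3) P5 = join P5 P6" using par_eqI j23 j56 par2 parallel_sym by blast
  then have 2: "P6 \<in> par (join P2 P3) P5" using j56 by simp
  have "P4 \<in> par (join P1 P6) P3"
  proof (cases "parallel l m")
    case True
    then have "l \<inter> m = {}" using P2 m unfolding parallel_def by auto
    then show ?thesis using pappus_parallel[OF l(1) m(1) _ l(2,3,4) m(2,3,4) 1 2] by simp
  next
    case False
    then obtain Z where Z: "Z \<in> l" "Z \<in> m" using meet_ex l m by blast
    have lm: "l \<noteq> m" using P2 m by auto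
    have meet: "X = Z" if "X \<in> l" "X \<in> m" for X using that Z l(1) m(1) lm line_unique by blast
    \<comment> \<open>No vertex may be \<open>Z\<close>. A vertex on both carriers makes a side of
      the hexagon equal to a carrier, and the parallel side, which has a vertex on that carrier,
      equals it too. Pursuing this ends with P2 on \<open>l\<close> or with P1 = P3.\<close>
    have "P4 \<notin> l"
    proof
      assume "P4 \<in> l"
      then have "join P1 P2 = l" using jl[of P4 P5] l ne par1 j12 parallel_eq by metis
      then show False using j12 P2 by simp
    qed
    moreover have "P6 \<notin> l"
    proof
      assume "P6 \<in> l"
      then have "join P2 P3 = l" using jl[of P5 P6] l ne par2 j23 parallel_eq by metis
      then show False using j23 P2 by simp
    qed
    moreover have P5m: "P1 \<in> m" if "P5 \<in> m"
    proof -
      have "join P1 P2 = m" using jm[of P4 P5] that m ne par1 j12 parallel_eq by metis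
      then show ?thesis using j12 by simp
    qed
    moreover have P1m: "P1 \<notin> m"
    proof
      assume P1: "P1 \<in> m"
      then have "join P4 P5 = m" using jm[of P1 P2] m ne par1 j45 parallel_eq by metis
      then have "P5 \<in> m" using j45 by simp
      then have "join P2 P3 = m" using jm[of P5 P6] m ne par2 j23 parallel_eq by metis
      then have "P3 \<in> m" using j23 by simp
      then show False using P1 meet l ne by metis
    qed
    moreover have "P3 \<notin> m"
    proof
      assume P3: "P3 \<in> m"
      then have "join P5 P6 = m" using jm[of P2 P3] m ne par2 j56 parallel_eq by metis
      then have "P5 \<in> m" using j56 by simp
      then show False using P5m P1m by simp
    qed
    ultimately have P: "P1 \<in> l - {Z}" "P3 \<in> l - {Z}" "P5 \<in> l - {Z}"
      and Q: "P2 \<in> m - {Z}" "P4 \<in> m - {Z}" "P6 \<in> m - {Z}"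
      using l m Z P2 by auto
    interpret pointed_desargues_plane Pts L Z
      by unfold_locales (use Z l line_point in blast)
    show ?thesis using pappus_central[OF l(1) Z(1) m(1) Z(2) lm P Q 1 2] .
  qed
  moreover have "join P1 P6 \<in> L" using j[of P1 P6] pts ne by auto
  ultimately have "join P3 P4 = par (join P1 P6) P3"
    using line_through_eq[of "par (join P1 P6) P3" P3 P4] par[of "join P1 P6" P3] pts ne by auto
  then show "parallel (join P3 P4) (join P1 P6)"
    using par[of "join P1 P6" P3] \<open>join P1 P6 \<in> L\<close> pts by simp
qed

end

section \<open>Planes with two points on each line\<close>

context affine_plane
begin

text \<open>If two parallels \<open>a\<close> and \<open>b\<close> cover the plane, a line joining
  \<open>U\<close> on \<open>a\<close> to \<open>V\<close> on \<open>b\<close> has no further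
  points. Were X, Y, Z distinct on \<open>a\<close>, with P and Q on \<open>b\<close>, both
  \<open>join Y Q\<close> and \<open>join Z Q\<close> would be the parallel to
  \<open>join X P\<close> through \<open>Q\<close>. Three points of any line \<open>n\<close>
  include two on the same parallel, so \<open>n\<close> is \<open>a\<close> or
  \<open>b\<close>.\<close>

lemma two_points_of_two_parallels:
  assumes l: "l \<in> L" and A: "A \<in> Pts" and B: "B \<in> Pts"
    and cover: "\<And>C. C \<in> Pts \<Longrightarrow> C \<in> par l A \<or> C \<in> par l B"
    and n: "n \<in> L" "X \<in> n" "Y \<in> n" "Z \<in> n"
  shows "X = Y \<or> X = Z \<or> Y = Z"
proof (rule ccontr)
  assume ne: "\<not> (X = Y \<or> X = Z \<or> Y = Z)"
  have key: False
    if a: "a \<in> L" "b \<in> L" "a \<inter> b = {}" "\<And>C. C \<in> Pts \<Longrightarrow> C \<in> a \<or> C \<in> b"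
      and X: "X \<in> a" "Y \<in> a" "Z \<in> a" for a b
  proof -
    obtain P where P: "P \<in> b" using other_point[OF a(2) A] by blast
    have "P \<in> Pts" using P a line_point by blast
    then obtain Q where Q: "Q \<in> b" "Q \<noteq> P" using other_point[OF a(2)] by blast
    have j: "join U V \<in> L" "U \<in> join U V" "V \<in> join U V" if "U \<in> a" "V \<in> b" for U V
      using line_through[of U V] that a line_point by auto
    have meet: "W = U \<or> W = V" if "U \<in> a" "V \<in> b" "W \<in> join U V" for U V W
    proof -
      have "W \<in> Pts" using that j line_point by blast
      then consider "W \<in> a" | "W \<in> b" using a by blast
      then show ?thesis
      proof cases
        case 1
        then have "W = U \<or> join U V = a" using line_unique j[OF that(1,2)] a that by metis
        then show ?thesis using j[OF that(1,2)] that a by auto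
      next
        case 2
        then have "W = V \<or> join U V = b" using line_unique j[OF that(1,2)] a that by metis
        then show ?thesis using j[OF that(1,2)] that a by auto
      qed
    qed
    have dis: "join X P \<inter> join U Q = {}" if "U \<in> a" "U \<noteq> X" for U
      using meet[OF X(1) P] meet[OF that(1) Q(1)] that X P Q a by blast
    have e: "par (join X P) Q = join U Q" if "U \<in> a" "U \<noteq> X" for U
      using par_eqI[of "join X P" "join U Q" Q] j[OF X(1) P] j[OF that(1) Q(1)] dis[OF that]
      unfolding parallel_def by blast
    have "join Y Q = join Z Q" using e[of Y] e[of Z] X ne by auto
    then have "Z \<in> join Y Q" using j[OF X(3) Q(1)] by simp
    then have "Z = Q" using meet[OF X(2) Q(1)] ne by auto
    then show False using X Q a by blast
  qed
  let ?a = "par l A" and ?b = "par l B"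
  have ab: "?a \<in> L" "?b \<in> L" "parallel ?a ?b"
    using par l A B parallel_trans parallel_sym by metis+
  obtain C where "C \<in> Pts" "C \<notin> ?a" using off_line ab by blast
  then have "?a \<noteq> ?b" using cover by metis
  then have dis: "?a \<inter> ?b = {}" using ab unfolding parallel_def by simp
  have "X \<in> Pts" "Y \<in> Pts" "Z \<in> Pts" using n line_point by auto
  then have "n = ?a \<or> n = ?b"
    using cover[of X] cover[of Y] cover[of Z] line_unique[OF n(1) ab(1)] line_unique[OF n(1) ab(2)] n ne by metis
  then show False using key[of ?a ?b] key[of ?b ?a] ab dis cover n by blast
qed

text \<open>P5 is P1 or P3; the former would put P1, P2 and P4 on one line. From P5 = P3 follows P6
  = P2 in the same way, and the conclusion becomes the first parallelism with its sides
  exchanged.\<close>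

lemma pappian_of_two_points:
  assumes two: "\<And>n X Y Z. n \<in> L \<Longrightarrow> X \<in> n \<Longrightarrow> Y \<in> n \<Longrightarrow> Z \<in> n \<Longrightarrow> X = Y \<or> X = Z \<or> Y = Z"
  shows "pappian Pts L"
  unfolding pappian_def
proof (intro ballI impI)
  fix P1 P2 P3 P4 P5 P6
  assume pts: "P1 \<in> Pts" "P2 \<in> Pts" "P3 \<in> Pts" "P4 \<in> Pts" "P5 \<in> Pts" "P6 \<in> Pts"
    and ne: "P1 \<noteq> P3" "P2 \<noteq> P4" "P1 \<noteq> P2" "P2 \<noteq> P3" "P3 \<noteq> P4" "P4 \<noteq> P5" "P5 \<noteq> P6" "P6 \<noteq> P1"
    and P5: "P5 \<in> join P1 P3"
    and par1: "parallel (join P1 P2) (join P4 P5)" and par2: "parallel (join P2 P3) (join P5 P6)"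
  have j: "join X Y \<in> L" "X \<in> join X Y" "Y \<in> join X Y" if "X \<in> Pts" "Y \<in> Pts" "X \<noteq> Y" for X Y
    using line_through that by auto
  note j12 = j[OF pts(1,2) ne(3)] and j45 = j[OF pts(4,5) ne(6)]
    and j23 = j[OF pts(2,3) ne(4)] and j56 = j[OF pts(5,6) ne(7)]
  have "P5 \<noteq> P1"
  proof
    assume e: "P5 = P1"
    then have "join P1 P2 = join P4 P5" using par1 parallel_eq j12 j45 by metis
    then show False using two[of "join P1 P2" P1 P2 P4] j12 j45 ne e by auto
  qed
  then have P53: "P5 = P3" using two[of "join P1 P3" P1 P3 P5] P5 j[OF pts(1,3) ne(1)] ne by auto
  then have "join P2 P3 = join P5 P6" using par2 parallel_eq j23 j56 by metis
  then have "P6 = P2" using two[of "join P2 P3" P2 P3 P6] j23 j56 ne P53 by auto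
  then show "parallel (join P3 P4) (join P1 P6)"
    using par1 P53 parallel_sym join_commute by metis
qed

end

theorem theorem3p4:
  fixes Pts :: "'a set" and L :: "'a set set" and \<delta> :: "'a \<Rightarrow> 'a"
  assumes "finite_desargues_affine_plane Pts L"
    and "dilatation Pts L \<delta>"
  shows "pappian Pts L"
proof -
  interpret finite_desargues_affine_plane Pts L by fact
  show ?thesis
  proof (cases "\<exists>l\<in>L. \<exists>A\<in>Pts. \<exists>B\<in>Pts. \<forall>C\<in>Pts. C \<in> par l A \<or> C \<in> par l B")
    case True
    then obtain l A B where "l \<in> L" "A \<in> Pts" "B \<in> Pts"
      and "\<And>C. C \<in> Pts \<Longrightarrow> C \<in> par l A \<or> C \<in> par l B" by blast
    then show ?thesis using pappian_of_two_points two_points_of_two_parallels by blast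
  next
    case False
    then interpret thick_desargues_plane Pts L by unfold_locales blast
    show ?thesis by (rule pappian_thick)
  qed
qed

end
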